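(* Let $E$ be a (real) UMD Banach space, let $1<p<\infty$ and let $m\ge1$. There is a constant $C\ge1$ depending only on $p$, $m$ and $E$ such that the following holds. Let $n\ge1$ and let $(x_{\mathbf{i}})_{|\mathbf{i}|=m}\subset E$ satisfy $x_{\mathbf{i}}=x_{\mathbf{i}'}$ whenever $\mathbf{i}'$ is a permutation of $\mathbf{i}$, and set $$F := \sum_{|\mathbf{i}|=m,\ |\mathbf{i}|_\infty\le n}(\mathbf{i}!/m!)^{1/2}\,\Psi_{\mathbf{i}}\,x_{\mathbf{i}},\qquad \widetilde F := \sum_{|\mathbf{i}|=m,\ |\mathbf{i}|_\infty\le n}\gamma^{(1)}_{i_1}\cdots\gamma^{(m)}_{i_m}\,x_{\mathbf{i}}.$$ Then $$C^{-1}\|\widetilde F\|_{L^p(\Omega;E)}\le\|F\|_{L^p(\Omega;E)}\le C\|\widetilde F\|_{L^p(\Omega;E)}.$$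
   Context: $(\gamma_j)_{j\ge1}$ is a sequence of independent standard Gaussian random variables on a (sufficiently rich) probability space $(\Omega,\mathcal{F},\mathbb{P})$, and $(\gamma_j^{(k)})_{j\ge1}$, $k\ge1$, are independent copies of this sequence (so that all $\gamma_j^{(k)}$, $j,k\ge 1$, are independent standard Gaussians). For a finite sequence $\mathbf{i}=(i_1,\ldots,i_m)$ with values in $\{1,2,\ldots\}$ and $j\ge1$: $j(\mathbf{i})=\#\{k:1\le k\le m,\ i_k=j\}$, $|\mathbf{i}|=m$ (the length), $|\mathbf{i}|_\infty=\max_{1\le k\le m}i_k$, $\mathbf{i}!=\prod_{j\ge1}j(\mathbf{i})!$. The Hermite polynomials satisfy $H_0(x)=1$, $H_1(x)=x$, $(m+1)H_{m+1}(x)=xH_m(x)-H_{m-1}(x)$ for $m\ge1$, and $\Psi_{\mathbf{i}}=(\mathbf{i}!)^{1/2}\prod_{j\ge1}H_{j(\mathbf{i})}(\gamma_j)$. *)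

theory Defs
  imports "HOL-Probability.Probability"
begin

section \<open>Bochner integration in a possibly nonseparable Banach space\<close>

text \<open>
  The library's \<^const>\<open>has_bochner_integral\<close> requires the target to be second countable, which
  would restrict the results to separable Banach spaces.  The next two definitions drop this
  restriction: Borel measurability is replaced by strong measurability (to which it is
  equivalent for separable targets); everything else is as in the library.
\<close>

definition strongly_measurable :: "'w measure \<Rightarrow> ('w \<Rightarrow> 'e::real_normed_vector) \<Rightarrow> bool" where
  "strongly_measurable M f \<longleftrightarrow>
     (\<exists>s. (\<forall>i::nat. simple_function M (s i)) \<and>
          (\<forall>\<omega>\<in>space M. (\<lambda>i. s i \<omega>) \<longlonglongrightarrow> f \<omega>))"

definition has_strong_bochner_integral ::
    "'w measure \<Rightarrow> ('w \<Rightarrow> 'e::real_normed_vector) \<Rightarrow> 'e \<Rightarrow> bool" where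
  "has_strong_bochner_integral M f v \<longleftrightarrow>
     strongly_measurable M f \<and>
     (\<exists>s. (\<forall>i::nat. Bochner_Integration.simple_bochner_integrable M (s i)) \<and>
          (\<lambda>i. \<integral>\<^sup>+\<omega>. ennreal (norm (f \<omega> - s i \<omega>)) \<partial>M) \<longlonglongrightarrow> 0 \<and>
          (\<lambda>i. Bochner_Integration.simple_bochner_integral M (s i)) \<longlonglongrightarrow> v)"

section \<open>Lebesgue-Bochner spaces\<close>

definition in_Lp :: "'w measure \<Rightarrow> real \<Rightarrow> ('w \<Rightarrow> 'e::real_normed_vector) \<Rightarrow> bool" where
  "in_Lp M p f \<longleftrightarrow> strongly_measurable M f \<and> integrable M (\<lambda>\<omega>. norm (f \<omega>) powr p)"

text \<open>
  Only meaningful on \<^const>\<open>in_Lp\<close>.  It is used below for martingale differences assumed to be in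
  this space, and for polynomials in Gaussian variables, which have moments of all orders.
\<close>

definition Lp_norm :: "'w measure \<Rightarrow> real \<Rightarrow> ('w \<Rightarrow> 'e::real_normed_vector) \<Rightarrow> real" where
  "Lp_norm M p f = (\<integral>\<omega>. norm (f \<omega>) powr p \<partial>M) powr (1 / p)"

section \<open>UMD Banach spaces\<close>

text \<open>\<open>g\<close> is a version of the conditional expectation of \<open>f\<close> given \<open>G\<close>.\<close>

definition is_cond_exp ::
    "'w measure \<Rightarrow> 'w measure \<Rightarrow> ('w \<Rightarrow> 'e::real_normed_vector) \<Rightarrow> ('w \<Rightarrow> 'e) \<Rightarrow> bool" where
  "is_cond_exp M G f g \<longleftrightarrow>
     strongly_measurable G g \<and>
     (\<forall>A\<in>sets G. \<exists>v.
        has_strong_bochner_integral M (\<lambda>\<omega>. indicator A \<omega> *\<^sub>R f \<omega>) v \<and>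
        has_strong_bochner_integral M (\<lambda>\<omega>. indicator A \<omega> *\<^sub>R g \<omega>) v)"

text \<open>
  The martingale starts with \<open>d 1\<close>, which is not required to have mean zero.  The values of \<open>F\<close> and
  \<open>d\<close> outside \<open>{1..N}\<close> are irrelevant.
\<close>

definition martingale_differences ::
    "'w measure \<Rightarrow> real \<Rightarrow> nat \<Rightarrow> (nat \<Rightarrow> 'w measure) \<Rightarrow> (nat \<Rightarrow> 'w \<Rightarrow> 'e::real_normed_vector) \<Rightarrow> bool"
  where
  "martingale_differences M p N F d \<longleftrightarrow>
     (\<forall>j\<in>{1..N}. subalgebra M (F j)) \<and>
     (\<forall>i\<in>{1..N}. \<forall>j\<in>{1..N}. i \<le> j \<longrightarrow> subalgebra (F j) (F i)) \<and>
     (\<forall>j\<in>{1..N}. strongly_measurable (F j) (d j) \<and> in_Lp M p (d j)) \<and>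
     (\<forall>j\<in>{1..<N}. is_cond_exp M (F j) (d (Suc j)) (\<lambda>_. 0))"

text \<open>
  HOL cannot quantify over the carrier types of probability spaces inside a definition, so all
  probability measures, on all \<sigma>-algebras, over the fixed type \<^typ>\<open>nat \<Rightarrow> real\<close> are used.
  Nothing is lost: with respect to its own filtration, a finite martingale difference sequence of
  strongly measurable functions is determined by its joint law, which lives on a Polish space and
  can be realised over this type.  As usual, the constant may depend on \<open>p\<close>.
\<close>

definition UMD_space :: "'e::banach itself \<Rightarrow> bool" where
  "UMD_space (_ :: 'e itself) \<longleftrightarrow>
     (\<forall>p::real. 1 < p \<longrightarrow> (\<exists>\<beta>::real. 0 \<le> \<beta> \<and>
        (\<forall>(M :: (nat \<Rightarrow> real) measure) (N::nat) F (d :: nat \<Rightarrow> (nat \<Rightarrow> real) \<Rightarrow> 'e) (\<epsilon> :: nat \<Rightarrow> real).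
           prob_space M \<longrightarrow> martingale_differences M p N F d \<longrightarrow> (\<forall>j\<in>{1..N}. \<epsilon> j \<in> {-1, 1}) \<longrightarrow>
           Lp_norm M p (\<lambda>\<omega>. \<Sum>j=1..N. \<epsilon> j *\<^sub>R d j \<omega>)
             \<le> \<beta> * Lp_norm M p (\<lambda>\<omega>. \<Sum>j=1..N. d j \<omega>))))"

section \<open>Gaussian chaos\<close>

definition iid_std_gaussian :: "'w measure \<Rightarrow> 'i set \<Rightarrow> ('i \<Rightarrow> 'w \<Rightarrow> real) \<Rightarrow> bool" where
  "iid_std_gaussian M I X \<longleftrightarrow>
     prob_space.indep_vars M (\<lambda>_. borel) X I \<and>
     (\<forall>i\<in>I. distributed M lborel (X i) (\<lambda>t. ennreal (std_normal_density t)))"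

text \<open>Normalised such that \<open>hermite m\<close> has leading coefficient \<open>1 / fact m\<close>.\<close>

fun hermite :: "nat \<Rightarrow> real \<Rightarrow> real" where
  "hermite 0 t = 1"
| "hermite (Suc 0) t = t"
| "hermite (Suc (Suc m)) t = (t * hermite (Suc m) t - hermite m t) / real (m + 2)"

text \<open>
  A finite sequence of positive integers is a list; \<open>multi_indices m n\<close> are those of length \<open>m\<close> with
  all entries at most \<open>n\<close>.  In the products below, indices not occurring in the list contribute the
  factors \<open>fact 0 = 1\<close> and \<open>hermite 0 t = 1\<close>.
\<close>

definition multi_indices :: "nat \<Rightarrow> nat \<Rightarrow> nat list set" where
  "multi_indices m n = {is. length is = m \<and> set is \<subseteq> {1..n}}"

definition multi_fact :: "nat list \<Rightarrow> real" where
  "multi_fact is = (\<Prod>j\<in>set is. fact (count_list is j))"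

definition Psi :: "(nat \<Rightarrow> 'w \<Rightarrow> real) \<Rightarrow> nat list \<Rightarrow> 'w \<Rightarrow> real" where
  "Psi \<gamma> is \<omega> = sqrt (multi_fact is) * (\<Prod>j\<in>set is. hermite (count_list is j) (\<gamma> j \<omega>))"

definition symmetric_family :: "nat \<Rightarrow> (nat list \<Rightarrow> 'e) \<Rightarrow> bool" where
  "symmetric_family m x \<longleftrightarrow>
     (\<forall>is is'. length is = m \<longrightarrow> set is \<subseteq> {1..} \<longrightarrow> mset is' = mset is \<longrightarrow> x is = x is')"

definition chaos ::
    "(nat \<Rightarrow> 'w \<Rightarrow> real) \<Rightarrow> nat \<Rightarrow> nat \<Rightarrow> (nat list \<Rightarrow> 'e::real_normed_vector) \<Rightarrow> 'w \<Rightarrow> 'e" where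
  "chaos \<gamma> m n x \<omega> =
     (\<Sum>is\<in>multi_indices m n. (sqrt (multi_fact is / fact m) * Psi \<gamma> is \<omega>) *\<^sub>R x is)"

text \<open>
  \<open>\<gamma>' (k, j)\<close> is the \<open>j\<close>-th variable of the \<open>k\<close>-th copy; list positions start at \<open>0\<close>, copies at \<open>1\<close>.
\<close>

definition decoupled_chaos ::
    "(nat \<times> nat \<Rightarrow> 'w \<Rightarrow> real) \<Rightarrow> nat \<Rightarrow> nat \<Rightarrow> (nat list \<Rightarrow> 'e::real_normed_vector) \<Rightarrow> 'w \<Rightarrow> 'e" where
  "decoupled_chaos \<gamma>' m n x \<omega> =
     (\<Sum>is\<in>multi_indices m n. (\<Prod>k=1..m. \<gamma>' (k, is ! (k - 1)) \<omega>) *\<^sub>R x is)"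

end

theory Submission
  imports Defs
begin

text \<open>
  Let \<open>h k = fact k * hermite k\<close> be the monic Hermite polynomials. Up to the factor \<open>sqrt (fact m)\<close>,
  the coefficient of \<open>x is\<close> in the chaos \<open>F\<close> is the product of the \<open>h (count_list is j)\<close> at \<open>\<gamma> j\<close>, that is,
  the Wick product of the variables listed by \<open>is\<close>. The proof interpolates between \<open>F\<close> and the
  decoupled chaos. Arrange independent standard Gaussian variables in \<open>m\<close> rows, and for \<open>1 \<le> k \<le> m\<close> let
  \<open>Q k\<close> be the sum over all \<open>is\<close> of \<open>x is\<close> times the Wick product of the row-1 variables at the first \<open>k\<close>
  entries of \<open>is\<close> times the product, over the remaining positions \<open>l\<close>, of the variable of row \<open>l\<close> at the
  entry in position \<open>l\<close>. Then \<open>Q 1\<close> is the decoupled chaos and \<open>Q m\<close> has the law of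
  \<open>sqrt (fact m)\<close> times \<open>F\<close>. It remains to compare the \<open>p\<close>-th moments of \<open>Q k\<close> and \<open>Q (k + 1)\<close> up to
  constants depending on \<open>k\<close> and \<open>p\<close>.

  Both comparisons use that the law of the array does not change when the pair (row 1, row \<open>k + 1\<close>)
  is replaced by (\<open>c\<close> row 1 + \<open>s\<close> row \<open>k + 1\<close>, \<open>s\<close> row 1 - \<open>c\<close> row \<open>k + 1\<close>) with \<open>c\<^sup>2 + s\<^sup>2 = 1\<close>
  (\<open>nn_integral_reflect_rows\<close>).

  \<^item> Apply this to \<open>Q k\<close> with \<open>c = s\<close> and integrate out row \<open>k + 1\<close>. By Mehler's formula
    (\<open>mehler_hermite\<close>, \<open>mehler_hermite_mult\<close>) the result is \<open>s * c ^ k\<close> times \<open>Q (k + 1)\<close>, and by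
    Jensen's inequality integrating out does not increase the \<open>p\<close>-th moment
    (\<open>chaos_moment_Suc_le\<close>).

  \<^item> \<open>Q (k + 1)\<close> does not involve row \<open>k + 1\<close>. Apply the isometry with \<open>s = t * c\<close> to it and multiply by
    \<open>sqrt (1 + t\<^sup>2) ^ (k + 1)\<close>. This gives a polynomial in \<open>t\<close> of degree at most \<open>k + 1\<close> whose linear
    coefficient moves one of the \<open>k + 1\<close> factors of the Wick product to row \<open>k + 1\<close>. As \<open>x\<close> is
    symmetric, each of the \<open>k + 1\<close> choices yields \<open>Q k\<close>. The linear coefficient is a fixed linear
    combination of the values at \<open>t = 1, 2, 4, \<dots>\<close>, so the triangle inequality bounds the moment of
    \<open>Q k\<close> by that of \<open>Q (k + 1)\<close> (\<open>chaos_moment_le_Suc\<close>).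

  The moments are integrals with values in \<open>[0, \<infinity>]\<close>; as they are compared in both directions, they
  are finite together or infinite together, and this passes to the norms.
\<close>

section \<open>The standard Gaussian measure and its planar isometries\<close>

definition gauss :: "real measure" where
  "gauss = density lborel (\<lambda>t. ennreal (std_normal_density t))"

lemma sets_gauss [measurable_cong, simp]: "sets gauss = sets borel"
  by (simp add: gauss_def)

lemma space_gauss [simp]: "space gauss = UNIV"
  by (simp add: gauss_def)

interpretation gauss: prob_space gauss
  unfolding gauss_def by (rule prob_space_normal_density) simp

interpretation gauss_product: product_prob_space "\<lambda>_ :: 'i. gauss" UNIV
  by unfold_locales

lemma prob_space_gauss_product: "prob_space (PiM K (\<lambda>_. gauss))"
  by (intro prob_space_PiM gauss.prob_space_axioms)

lemma nn_integral_gauss: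
  assumes [measurable]: "f \<in> borel_measurable borel"
  shows "(\<integral>\<^sup>+x. f x \<partial>gauss) = (\<integral>\<^sup>+x. ennreal (std_normal_density x) * f x \<partial>lborel)"
  unfolding gauss_def by (rule nn_integral_density) auto

text \<open>
  The map \<open>(x, y) \<mapsto> (c x + s y, s x - c y)\<close> is a reflection of the plane, hence preserves the density
  and Lebesgue measure. The latter is obtained from two affine substitutions in one variable with
  factors \<open>1 / s\<close> and \<open>s\<close>: first the second coordinate is replaced, then, after exchanging the order of
  integration, the first one.
\<close>
lemma nn_integral_gauss_pair_reflect:
  fixes F :: "real \<times> real \<Rightarrow> ennreal"
  assumes [measurable]: "F \<in> borel_measurable (borel \<Otimes>\<^sub>M borel)"
    and s: "0 < s" and cs: "c\<^sup>2 + s\<^sup>2 = 1"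
  shows "(\<integral>\<^sup>+x. (\<integral>\<^sup>+y. F (c * x + s * y, s * x - c * y) \<partial>gauss) \<partial>gauss)
       = (\<integral>\<^sup>+x. (\<integral>\<^sup>+y. F (x, y) \<partial>gauss) \<partial>gauss)"
proof -
  define G where "G = (\<lambda>(u,v). ennreal (std_normal_density u * std_normal_density v) * F (u, v))"
  have G[measurable]: "G \<in> borel_measurable (borel \<Otimes>\<^sub>M borel)"
    unfolding G_def by measurable
  have s2: "s * s = 1 - c * c"
    using cs by (simp add: power2_eq_square)
  have dens: "std_normal_density (c * x + s * y) * std_normal_density (s * x - c * y)
      = std_normal_density x * std_normal_density y" for x y
  proof -
    have sq: "(c * x + s * y)\<^sup>2 + (s * x - c * y)\<^sup>2 = x\<^sup>2 + y\<^sup>2"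
    proof -
      have "(c * x + s * y)\<^sup>2 + (s * x - c * y)\<^sup>2 = (c\<^sup>2 + s\<^sup>2) * (x\<^sup>2 + y\<^sup>2)"
        by (simp add: power2_eq_square algebra_simps)
      then show ?thesis using cs by simp
    qed
    have d: "std_normal_density u * std_normal_density v = 1 / (2 * pi) * exp (- (u\<^sup>2 + v\<^sup>2) / 2)" for u v
      unfolding std_normal_density_def
      by (simp add: mult_exp_exp diff_divide_distrib add_divide_distrib)
    show ?thesis unfolding d sq ..
  qed
  have iter: "(\<integral>\<^sup>+x. (\<integral>\<^sup>+y. H (x, y) \<partial>gauss) \<partial>gauss)
      = (\<integral>\<^sup>+x. (\<integral>\<^sup>+y. ennreal (std_normal_density x * std_normal_density y) * H (x, y) \<partial>lborel) \<partial>lborel)"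
    if [measurable]: "H \<in> borel_measurable (borel \<Otimes>\<^sub>M borel)" for H :: "real \<times> real \<Rightarrow> ennreal"
  proof -
    have "(\<integral>\<^sup>+x. (\<integral>\<^sup>+y. H (x, y) \<partial>gauss) \<partial>gauss)
        = (\<integral>\<^sup>+x. ennreal (std_normal_density x) * (\<integral>\<^sup>+y. H (x, y) \<partial>gauss) \<partial>lborel)"
      by (rule nn_integral_gauss) measurable
    also have "\<dots> = (\<integral>\<^sup>+x. (\<integral>\<^sup>+y. ennreal (std_normal_density x) * (ennreal (std_normal_density y) * H (x, y)) \<partial>lborel) \<partial>lborel)"
    proof (intro nn_integral_cong)
      fix x
      have "(\<integral>\<^sup>+y. H (x, y) \<partial>gauss) = (\<integral>\<^sup>+y. ennreal (std_normal_density y) * H (x, y) \<partial>lborel)"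
        by (rule nn_integral_gauss) measurable
      then show "ennreal (std_normal_density x) * (\<integral>\<^sup>+y. H (x, y) \<partial>gauss)
          = (\<integral>\<^sup>+y. ennreal (std_normal_density x) * (ennreal (std_normal_density y) * H (x, y)) \<partial>lborel)"
        by (subst nn_integral_cmult) (auto intro!: measurable_Pair)
    qed
    finally show ?thesis by (simp add: ennreal_mult mult.assoc)
  qed
  let ?H = "\<lambda>u x. ennreal (1 / s) * G (u, - (c * u) / s + (1 / s) * x)"
  \<comment> \<open>For fixed \<open>u = c x + s y\<close>, the second coordinate is \<open>v = s x - c y = (x - c u) / s\<close>.\<close>
  have inner: "(\<integral>\<^sup>+v. G (u, v) \<partial>lborel) = (\<integral>\<^sup>+x. ?H u x \<partial>lborel)" for u
    using s nn_integral_real_affine [of "\<lambda>v. G (u, v)" "1 / s" "- (c * u) / s"]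
    by (simp add: nn_integral_cmult)
  have outer: "(\<integral>\<^sup>+u. ?H u x \<partial>lborel) = (\<integral>\<^sup>+y. G (c * x + s * y, s * x - c * y) \<partial>lborel)" for x
  proof -
    have *: "- (c * (c * x + s * y)) / s + (1 / s) * x = s * x - c * y" for y
    proof -
      have "- (c * (c * x + s * y)) + x = s * (s * x - c * y)"
        using arg_cong [OF s2, of "\<lambda>a. a * x"] by (simp add: algebra_simps)
      then show ?thesis using s by (simp add: field_simps)
    qed
    have "(\<integral>\<^sup>+u. ?H u x \<partial>lborel) = ennreal s * (\<integral>\<^sup>+y. ?H (c * x + s * y) x \<partial>lborel)"
      using s nn_integral_real_affine [of "\<lambda>u. ?H u x" s "c * x"] by simp
    then have "(\<integral>\<^sup>+u. ?H u x \<partial>lborel) = (\<integral>\<^sup>+y. ennreal s * ?H (c * x + s * y) x \<partial>lborel)"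
      by (subst nn_integral_cmult) auto
    then have 1: "(\<integral>\<^sup>+u. ?H u x \<partial>lborel) = (\<integral>\<^sup>+y. ennreal s * (ennreal (1 / s) * G (c * x + s * y, s * x - c * y)) \<partial>lborel)"
      unfolding * .
    have "ennreal s * ennreal (1 / s) = 1"
      using s by (simp flip: ennreal_mult)
    with 1 show ?thesis
      by (simp flip: mult.assoc)
  qed
  have "(\<integral>\<^sup>+x. (\<integral>\<^sup>+y. F (x, y) \<partial>gauss) \<partial>gauss) = (\<integral>\<^sup>+u. (\<integral>\<^sup>+v. G (u, v) \<partial>lborel) \<partial>lborel)"
    using iter [of F] by (simp add: G_def)
  moreover have "(\<integral>\<^sup>+u. (\<integral>\<^sup>+v. G (u, v) \<partial>lborel) \<partial>lborel) = (\<integral>\<^sup>+u. (\<integral>\<^sup>+x. ?H u x \<partial>lborel) \<partial>lborel)"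
    unfolding inner ..
  moreover have "(\<integral>\<^sup>+u. (\<integral>\<^sup>+x. ?H u x \<partial>lborel) \<partial>lborel) = (\<integral>\<^sup>+x. (\<integral>\<^sup>+u. ?H u x \<partial>lborel) \<partial>lborel)"
    by (rule lborel_pair.Fubini') measurable
  moreover have "(\<integral>\<^sup>+x. (\<integral>\<^sup>+u. ?H u x \<partial>lborel) \<partial>lborel)
      = (\<integral>\<^sup>+x. (\<integral>\<^sup>+y. G (c * x + s * y, s * x - c * y) \<partial>lborel) \<partial>lborel)"
    unfolding outer ..
  moreover have "\<dots> = (\<integral>\<^sup>+x. (\<integral>\<^sup>+y. F (c * x + s * y, s * x - c * y) \<partial>gauss) \<partial>gauss)"
    using iter [of "\<lambda>(x, y). F (c * x + s * y, s * x - c * y)"] by (simp add: G_def dens)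
  ultimately show ?thesis by simp
qed

text \<open>
  The target may be nonseparable, so measurability is read off from the coefficients: the norm of the
  combination is a continuous function of countably many real numbers, for which the product and the Borel
  \<open>\<sigma>\<close>-algebra agree.
\<close>
lemma borel_measurable_norm_combination:
  fixes y :: "'a::countable \<Rightarrow> 'b::real_normed_vector"
  assumes "\<And>i. i \<in> A \<Longrightarrow> c i \<in> borel_measurable M"
  shows "(\<lambda>\<omega>. norm (\<Sum>i\<in>A. c i \<omega> *\<^sub>R y i)) \<in> borel_measurable M"
proof -
  have "continuous_on UNIV (\<lambda>a :: 'a \<Rightarrow> real. norm (\<Sum>i\<in>A. a i *\<^sub>R y i))"
    by (intro continuous_intros continuous_on_product_coordinates)
  from borel_measurable_continuous_onI [OF this]
  have [measurable]: "(\<lambda>a :: 'a \<Rightarrow> real. norm (\<Sum>i\<in>A. a i *\<^sub>R y i)) \<in> borel_measurable borel" .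
  have [measurable]: "(\<lambda>\<omega> i. if i \<in> A then c i \<omega> else 0) \<in> borel_measurable M"
  proof (rule measurable_coordinatewise_then_product)
    show "(\<lambda>\<omega>. if i \<in> A then c i \<omega> else 0) \<in> borel_measurable M" for i
      using assms by (cases "i \<in> A") auto
  qed
  have "(\<lambda>\<omega>. (\<lambda>a. norm (\<Sum>i\<in>A. a i *\<^sub>R y i)) (\<lambda>i. if i \<in> A then c i \<omega> else 0)) \<in> borel_measurable M"
    by measurable
  then show ?thesis by simp
qed

text \<open>
  The norm of an integral is at most the integral of the norm, for a possibly nonseparable target:
  only the scalar coefficients are approximated in \<open>L\<^sup>1\<close>, by simple functions, and for these the
  inequality is the triangle inequality for finite sums.
\<close>
lemma norm_integral_combination_le:
  fixes y :: "'a::countable \<Rightarrow> 'b::real_normed_vector"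
  assumes "finite A" and int: "\<And>i. i \<in> A \<Longrightarrow> has_bochner_integral M (c i) (d i)"
  shows "ennreal (norm (\<Sum>i\<in>A. d i *\<^sub>R y i)) \<le> (\<integral>\<^sup>+\<omega>. ennreal (norm (\<Sum>i\<in>A. c i \<omega> *\<^sub>R y i)) \<partial>M)"
proof -
  have "\<forall>i\<in>A. \<exists>s. (\<forall>k. Bochner_Integration.simple_bochner_integrable M (s k)) \<and>
      (\<lambda>k. \<integral>\<^sup>+\<omega>. ennreal (norm (c i \<omega> - s k \<omega>)) \<partial>M) \<longlonglongrightarrow> 0 \<and>
      (\<lambda>k. Bochner_Integration.simple_bochner_integral M (s k)) \<longlonglongrightarrow> d i"
  proof
    fix i assume "i \<in> A"
    from int [OF this] show "\<exists>s. (\<forall>k. Bochner_Integration.simple_bochner_integrable M (s k)) \<and>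
      (\<lambda>k. \<integral>\<^sup>+\<omega>. ennreal (norm (c i \<omega> - s k \<omega>)) \<partial>M) \<longlonglongrightarrow> 0 \<and>
      (\<lambda>k. Bochner_Integration.simple_bochner_integral M (s k)) \<longlonglongrightarrow> d i"
      by cases blast
  qed
  from bchoice [OF this] obtain s where s: "\<And>i k. i \<in> A \<Longrightarrow> Bochner_Integration.simple_bochner_integrable M (s i k)"
    and s0: "\<And>i. i \<in> A \<Longrightarrow> (\<lambda>k. \<integral>\<^sup>+\<omega>. ennreal (norm (c i \<omega> - s i k \<omega>)) \<partial>M) \<longlonglongrightarrow> 0"
    and sd: "\<And>i. i \<in> A \<Longrightarrow> (\<lambda>k. Bochner_Integration.simple_bochner_integral M (s i k)) \<longlonglongrightarrow> d i"
    by blast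
  let ?I = "Bochner_Integration.simple_bochner_integral M"
  let ?T = "\<lambda>k \<omega>. \<Sum>i\<in>A. s i k \<omega> *\<^sub>R y i"
  have [measurable]: "\<And>i. i \<in> A \<Longrightarrow> c i \<in> borel_measurable M"
    using int by (auto elim: has_bochner_integral.cases)
  have sm [measurable]: "\<And>i k. i \<in> A \<Longrightarrow> s i k \<in> borel_measurable M"
    using s by (auto elim!: simple_bochner_integrable.cases intro: borel_measurable_simple_function)
  have T: "Bochner_Integration.simple_bochner_integrable M (\<lambda>\<omega>. \<Sum>i\<in>B. s i k \<omega> *\<^sub>R y i) \<and>
      ?I (\<lambda>\<omega>. \<Sum>i\<in>B. s i k \<omega> *\<^sub>R y i) = (\<Sum>i\<in>B. ?I (s i k) *\<^sub>R y i)" if "B \<subseteq> A" for B k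
  proof -
    have "finite B" using that \<open>finite A\<close> finite_subset by blast
    then show ?thesis using that
    proof induction
      case empty
      have "Bochner_Integration.simple_bochner_integrable M (\<lambda>_. 0 :: 'b)"
        by (simp add: simple_bochner_integrable.simps)
      moreover have "?I (\<lambda>_. 0 :: 'b) = 0"
        unfolding simple_bochner_integral_def by (intro sum.neutral) auto
      ultimately show ?case by simp
    next
      case (insert i B)
      then have i: "i \<in> A" by simp
      have "linear (\<lambda>a. a *\<^sub>R y i)"
        by (rule linear_scaleR_left)
      from simple_bochner_integral_linear [OF this s [OF i, of k]]
      have 1: "?I (\<lambda>\<omega>. s i k \<omega> *\<^sub>R y i) = ?I (s i k) *\<^sub>R y i" .
      have 2: "Bochner_Integration.simple_bochner_integrable M (\<lambda>\<omega>. s i k \<omega> *\<^sub>R y i)"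
        by (rule simple_bochner_integrable_compose2 [of "\<lambda>a _. a *\<^sub>R y i", OF _ s [OF i] s [OF i]]) simp
      have 3: "Bochner_Integration.simple_bochner_integrable M (\<lambda>\<omega>. \<Sum>i\<in>B. s i k \<omega> *\<^sub>R y i)"
        using insert by simp
      have 4: "Bochner_Integration.simple_bochner_integrable M (\<lambda>\<omega>. s i k \<omega> *\<^sub>R y i + (\<Sum>i\<in>B. s i k \<omega> *\<^sub>R y i))"
        by (rule simple_bochner_integrable_compose2 [of "(+)", OF _ 2 3]) simp
      show ?case
        using insert.hyps insert.prems insert.IH simple_bochner_integral_add [OF 2 3] 4 by (simp add: 1)
    qed
  qed
  let ?u = "\<lambda>\<omega>. norm (\<Sum>i\<in>A. c i \<omega> *\<^sub>R y i)"
  let ?R = "\<lambda>k. \<Sum>i\<in>A. ennreal (norm (y i)) * (\<integral>\<^sup>+\<omega>. ennreal (norm (c i \<omega> - s i k \<omega>)) \<partial>M)"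
  have le: "ennreal (norm (\<Sum>i\<in>A. ?I (s i k) *\<^sub>R y i)) \<le> (\<integral>\<^sup>+\<omega>. ennreal (?u \<omega>) \<partial>M) + ?R k" for k
  proof -
    have Tk: "Bochner_Integration.simple_bochner_integrable M (?T k)"
      using T [of A k] by simp
    have Tn: "Bochner_Integration.simple_bochner_integrable M (\<lambda>\<omega>. norm (?T k \<omega>))"
      using simple_bochner_integrable_compose2 [of "\<lambda>a _. norm a", OF _ Tk Tk] by simp
    have "ennreal (norm (\<Sum>i\<in>A. ?I (s i k) *\<^sub>R y i)) = ennreal (norm (?I (?T k)))"
      using T [of A k] by simp
    also have "\<dots> \<le> ennreal (?I (\<lambda>\<omega>. norm (?T k \<omega>)))"
      by (intro ennreal_leI simple_bochner_integral_norm_bound Tk)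
    also have "\<dots> = (\<integral>\<^sup>+\<omega>. norm (?T k \<omega>) \<partial>M)"
      by (rule simple_bochner_integral_eq_nn_integral [OF Tn]) simp
    also have "\<dots> \<le> (\<integral>\<^sup>+\<omega>. ennreal (?u \<omega>) + (\<Sum>i\<in>A. ennreal (norm (y i)) * ennreal (norm (c i \<omega> - s i k \<omega>))) \<partial>M)"
    proof (rule nn_integral_mono)
      fix \<omega>
      have "?T k \<omega> = (\<Sum>i\<in>A. c i \<omega> *\<^sub>R y i) - (\<Sum>i\<in>A. (c i \<omega> - s i k \<omega>) *\<^sub>R y i)"
        by (simp add: sum_subtractf [symmetric] algebra_simps)
      then have "norm (?T k \<omega>) \<le> ?u \<omega> + norm (\<Sum>i\<in>A. (c i \<omega> - s i k \<omega>) *\<^sub>R y i)"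
        by (simp add: norm_triangle_ineq4)
      also have "\<dots> \<le> ?u \<omega> + (\<Sum>i\<in>A. norm (y i) * norm (c i \<omega> - s i k \<omega>))"
        using norm_sum [of "\<lambda>i. (c i \<omega> - s i k \<omega>) *\<^sub>R y i" A] by (simp add: mult.commute)
      finally have "ennreal (norm (?T k \<omega>)) \<le> ennreal (?u \<omega> + (\<Sum>i\<in>A. norm (y i) * norm (c i \<omega> - s i k \<omega>)))"
        by (rule ennreal_leI)
      also have "\<dots> = ennreal (?u \<omega>) + (\<Sum>i\<in>A. ennreal (norm (y i)) * ennreal (norm (c i \<omega> - s i k \<omega>)))"
        by (subst ennreal_plus) (auto intro: sum_nonneg simp: sum_ennreal [symmetric] ennreal_mult)
      finally show "ennreal (norm (?T k \<omega>)) \<le> \<dots>" .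
    qed
    also have "\<dots> \<le> (\<integral>\<^sup>+\<omega>. ennreal (?u \<omega>) \<partial>M) + (\<integral>\<^sup>+\<omega>. (\<Sum>i\<in>A. ennreal (norm (y i)) * ennreal (norm (c i \<omega> - s i k \<omega>))) \<partial>M)"
      by (subst nn_integral_add)
         (auto intro!: borel_measurable_norm_combination measurable_compose [OF _ measurable_ennreal] borel_measurable_sum)
    also have "(\<integral>\<^sup>+\<omega>. (\<Sum>i\<in>A. ennreal (norm (y i)) * ennreal (norm (c i \<omega> - s i k \<omega>))) \<partial>M) = ?R k"
      by (subst nn_integral_sum) (auto intro!: sum.cong nn_integral_cmult)
    finally show ?thesis .
  qed
  have "?R \<longlonglongrightarrow> (\<Sum>i\<in>A. ennreal (norm (y i)) * 0)"
    by (intro tendsto_sum ennreal_tendsto_cmult s0) auto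
  then have 1: "(\<lambda>k. (\<integral>\<^sup>+\<omega>. ennreal (?u \<omega>) \<partial>M) + ?R k) \<longlonglongrightarrow> (\<integral>\<^sup>+\<omega>. ennreal (?u \<omega>) \<partial>M) + 0"
    by (intro tendsto_add) auto
  have 2: "(\<lambda>k. ennreal (norm (\<Sum>i\<in>A. ?I (s i k) *\<^sub>R y i))) \<longlonglongrightarrow> ennreal (norm (\<Sum>i\<in>A. d i *\<^sub>R y i))"
    by (intro tendsto_ennrealI tendsto_norm tendsto_sum tendsto_scaleR sd tendsto_const)
  have "ennreal (norm (\<Sum>i\<in>A. d i *\<^sub>R y i)) \<le> (\<integral>\<^sup>+\<omega>. ennreal (?u \<omega>) \<partial>M) + 0"
    using le by (intro LIMSEQ_le [OF 2 1]) blast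
  then show ?thesis by simp
qed

section \<open>Gaussian product measures\<close>

text \<open>
  Let \<open>a\<close> be the norm of the integral and \<open>u\<close> the norm of the integrand, so that \<open>a \<le> \<integral> u\<close>.
  Young's inequality for \<open>u\<close> and \<open>a powr (p - 1)\<close>, integrated, bounds \<open>a powr p\<close> by
  \<open>(\<integral> u powr p) / p\<close> plus \<open>a powr p\<close> over the conjugate exponent; the last term is then absorbed.
\<close>
lemma jensen_norm_combination_powr:
  fixes y :: "'a::countable \<Rightarrow> 'b::real_normed_vector"
  assumes "prob_space M" and p: "1 < p" and "finite A"
    and int: "\<And>i. i \<in> A \<Longrightarrow> has_bochner_integral M (c i) (d i)"
  shows "ennreal (norm (\<Sum>i\<in>A. d i *\<^sub>R y i) powr p)
    \<le> (\<integral>\<^sup>+\<omega>. ennreal (norm (\<Sum>i\<in>A. c i \<omega> *\<^sub>R y i) powr p) \<partial>M)"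
proof -
  interpret prob_space M by fact
  define a where "a = norm (\<Sum>i\<in>A. d i *\<^sub>R y i)"
  define u where "u = (\<lambda>\<omega>. norm (\<Sum>i\<in>A. c i \<omega> *\<^sub>R y i))"
  have [measurable]: "u \<in> borel_measurable M"
    unfolding u_def using int by (intro borel_measurable_norm_combination) (auto elim: has_bochner_integral.cases)
  have a: "0 \<le> a" "ennreal a \<le> (\<integral>\<^sup>+\<omega>. ennreal (u \<omega>) \<partial>M)"
    unfolding a_def u_def using norm_integral_combination_le [OF \<open>finite A\<close> int] by auto
  define q where "q = p / (p - 1)"
  have q: "1 < q" "1 / p + 1 / q = 1"
    using p by (auto simp: q_def field_simps)
  \<comment> \<open>The weight for which \<open>a * b\<close> and \<open>b powr q\<close> both equal \<open>a powr p\<close>.\<close>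
  define b where "b = a powr (p - 1)"
  have b: "0 \<le> b" "a * b = a powr p" "b powr q = a powr p"
    using a(1) p by (auto simp: b_def q_def powr_powr powr_mult_base)
  have "ennreal (a powr p) = ennreal b * ennreal a"
    using b a(1) by (simp add: mult.commute flip: ennreal_mult)
  also have "\<dots> \<le> ennreal b * (\<integral>\<^sup>+\<omega>. ennreal (u \<omega>) \<partial>M)"
    by (intro mult_left_mono a) auto
  also have "\<dots> = (\<integral>\<^sup>+\<omega>. ennreal b * ennreal (u \<omega>) \<partial>M)"
    by (rule nn_integral_cmult [symmetric]) measurable
  also have "\<dots> \<le> (\<integral>\<^sup>+\<omega>. ennreal (1 / p) * ennreal (u \<omega> powr p) + ennreal (a powr p / q) \<partial>M)"
  proof (rule nn_integral_mono)
    fix \<omega>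
    have "u \<omega> * b \<le> u \<omega> powr p / p + a powr p / q"
      using Youngs_inequality [OF p q, of "u \<omega>" b] b by (simp add: u_def)
    then have "ennreal (b * u \<omega>) \<le> ennreal (1 / p * u \<omega> powr p + a powr p / q)"
      by (intro ennreal_leI) (simp add: mult.commute)
    also have "\<dots> = ennreal (1 / p) * ennreal (u \<omega> powr p) + ennreal (a powr p / q)"
      using p q(1) by (subst ennreal_plus) (auto simp flip: ennreal_mult)
    finally show "ennreal b * ennreal (u \<omega>) \<le> ennreal (1 / p) * ennreal (u \<omega> powr p) + ennreal (a powr p / q)"
      using b(1) by (simp add: ennreal_mult u_def)
  qed
  also have "\<dots> = ennreal (1 / p) * (\<integral>\<^sup>+\<omega>. ennreal (u \<omega> powr p) \<partial>M) + ennreal (a powr p / q)"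
    by (subst nn_integral_add) (auto simp: nn_integral_cmult emeasure_space_1)
  finally have le: "ennreal (a powr p) \<le> ennreal (1 / p) * (\<integral>\<^sup>+\<omega>. ennreal (u \<omega> powr p) \<partial>M) + ennreal (a powr p / q)" .
  have "ennreal (a powr p) \<le> (\<integral>\<^sup>+\<omega>. ennreal (u \<omega> powr p) \<partial>M)"
  proof (cases "(\<integral>\<^sup>+\<omega>. ennreal (u \<omega> powr p) \<partial>M)" rule: ennreal_cases)
    case (real v)
    have "ennreal (1 / p * v + a powr p / q) = ennreal (1 / p) * ennreal v + ennreal (a powr p / q)"
      using real(1) p q(1) by (subst ennreal_plus) (auto simp flip: ennreal_mult)
    then have "ennreal (a powr p) \<le> ennreal (1 / p * v + a powr p / q)"
      using le unfolding real(2) by (simp only:)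
    then have "a powr p \<le> 1 / p * v + a powr p / q"
      using p q(1) real(1) by (subst (asm) ennreal_le_iff) auto
    then have "a powr p * (1 - 1 / q) \<le> v / p"
      by (simp add: algebra_simps)
    moreover have "1 - 1 / q = 1 / p"
      using q(2) by simp
    ultimately have "a powr p \<le> v"
      using p by (simp add: divide_le_cancel)
    then show ?thesis
      unfolding real(2) by (rule ennreal_leI)
  qed simp
  then show ?thesis
    by (simp add: a_def u_def)
qed

lemma borel_measurable_norm_combination_powr:
  fixes y :: "'a::countable \<Rightarrow> 'b::real_normed_vector"
  assumes "\<And>i. i \<in> A \<Longrightarrow> c i \<in> borel_measurable M"
  shows "(\<lambda>\<omega>. ennreal (norm (\<Sum>i\<in>A. c i \<omega> *\<^sub>R y i) powr p)) \<in> borel_measurable M"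
  using borel_measurable_norm_combination [OF assms, where y = y] by measurable

text \<open>
  The hypothesis \<open>int\<close> says that \<open>d i\<close> is the conditional expectation of \<open>c i\<close> given the coordinates in
  \<open>I\<close>; in particular \<open>d i\<close> does not change with the coordinates \<open>\<eta>\<close> in \<open>J\<close>.
\<close>
lemma nn_integral_conditional_jensen:
  fixes y :: "'a::countable \<Rightarrow> 'b::real_normed_vector"
  assumes p: "1 < p" and fin: "finite A" "finite I" "finite J" and disj: "I \<inter> J = {}"
    and c: "\<And>i. i \<in> A \<Longrightarrow> c i \<in> borel_measurable (PiM (I \<union> J) (\<lambda>_. gauss))"
    and d: "\<And>i. i \<in> A \<Longrightarrow> d i \<in> borel_measurable (PiM (I \<union> J) (\<lambda>_. gauss))"
    and int: "\<And>i \<omega> \<eta>. i \<in> A \<Longrightarrow> has_bochner_integral (PiM J (\<lambda>_. gauss))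
      (\<lambda>\<eta>'. c i (merge I J (\<omega>, \<eta>'))) (d i (merge I J (\<omega>, \<eta>)))"
  shows "(\<integral>\<^sup>+\<omega>. ennreal (norm (\<Sum>i\<in>A. d i \<omega> *\<^sub>R y i) powr p) \<partial>PiM (I \<union> J) (\<lambda>_. gauss))
    \<le> (\<integral>\<^sup>+\<omega>. ennreal (norm (\<Sum>i\<in>A. c i \<omega> *\<^sub>R y i) powr p) \<partial>PiM (I \<union> J) (\<lambda>_. gauss))"
proof -
  interpret J: prob_space "PiM J (\<lambda>_. gauss)"
    by (rule prob_space_gauss_product)
  let ?c = "\<lambda>\<omega>. ennreal (norm (\<Sum>i\<in>A. c i \<omega> *\<^sub>R y i) powr p)"
  let ?d = "\<lambda>\<omega>. ennreal (norm (\<Sum>i\<in>A. d i \<omega> *\<^sub>R y i) powr p)"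
  have m: "?c \<in> borel_measurable (PiM (I \<union> J) (\<lambda>_. gauss))" "?d \<in> borel_measurable (PiM (I \<union> J) (\<lambda>_. gauss))"
    by (rule borel_measurable_norm_combination_powr, erule c)
       (rule borel_measurable_norm_combination_powr, erule d)
  have le: "(\<integral>\<^sup>+\<eta>. ?d (merge I J (\<omega>, \<eta>)) \<partial>PiM J (\<lambda>_. gauss))
      \<le> (\<integral>\<^sup>+\<eta>. ?c (merge I J (\<omega>, \<eta>)) \<partial>PiM J (\<lambda>_. gauss))" for \<omega>
  proof -
    have "(\<integral>\<^sup>+\<eta>. ?d (merge I J (\<omega>, \<eta>)) \<partial>PiM J (\<lambda>_. gauss))
      \<le> (\<integral>\<^sup>+\<eta>. (\<integral>\<^sup>+\<eta>'. ?c (merge I J (\<omega>, \<eta>')) \<partial>PiM J (\<lambda>_. gauss)) \<partial>PiM J (\<lambda>_. gauss))"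
      by (intro nn_integral_mono jensen_norm_combination_powr J.prob_space_axioms p fin int)
    then show ?thesis
      by (simp add: J.emeasure_space_1)
  qed
  show ?thesis
    unfolding gauss_product.product_nn_integral_fold [OF disj fin(2,3) m(1)]
      gauss_product.product_nn_integral_fold [OF disj fin(2,3) m(2)]
    by (rule nn_integral_mono, rule le)
qed

lemma measurable_reflect_pair:
  assumes "a \<in> K" "b \<in> K"
  shows "(\<lambda>\<omega>. (\<omega>)(a := c * \<omega> a + s * \<omega> b, b := s * \<omega> a - c * \<omega> b))
    \<in> PiM K (\<lambda>_. gauss) \<rightarrow>\<^sub>M PiM K (\<lambda>_. gauss)"
proof (rule measurable_PiM_single')
  fix i assume "i \<in> K"
  have [measurable]: "(\<lambda>\<omega>. \<omega> j) \<in> borel_measurable (PiM K (\<lambda>_. gauss))" if "j \<in> K" for j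
    using measurable_component_singleton [OF that, of "\<lambda>_. gauss"]
    by (simp add: measurable_cong_sets [OF refl sets_gauss])
  show "(\<lambda>\<omega>. ((\<omega>)(a := c * \<omega> a + s * \<omega> b, b := s * \<omega> a - c * \<omega> b)) i) \<in> PiM K (\<lambda>_. gauss) \<rightarrow>\<^sub>M gauss"
    using assms \<open>i \<in> K\<close> by (cases "i = b"; cases "i = a") simp_all
qed (use assms in \<open>auto simp: space_PiM PiE_def extensional_def\<close>)

lemma nn_integral_gauss_product_reflect_pair:
  assumes "finite K" "a \<in> K" "b \<in> K" "a \<noteq> b" and s: "0 < s" and cs: "c\<^sup>2 + s\<^sup>2 = 1"
    and F: "F \<in> borel_measurable (PiM K (\<lambda>_. gauss))"
  shows "(\<integral>\<^sup>+\<omega>. F ((\<omega>)(a := c * \<omega> a + s * \<omega> b, b := s * \<omega> a - c * \<omega> b)) \<partial>PiM K (\<lambda>_. gauss))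
    = (\<integral>\<^sup>+\<omega>. F \<omega> \<partial>PiM K (\<lambda>_. gauss))"
proof -
  define L where "L = K - {a, b}"
  have K: "K = insert b (insert a L)" and L: "finite L" "a \<notin> L" "b \<notin> insert a L"
    using assms by (auto simp: L_def)
  have iter: "(\<integral>\<^sup>+\<omega>. G \<omega> \<partial>PiM K (\<lambda>_. gauss))
      = (\<integral>\<^sup>+\<omega>. (\<integral>\<^sup>+x. (\<integral>\<^sup>+y. G ((\<omega>)(a := x, b := y)) \<partial>gauss) \<partial>gauss) \<partial>PiM L (\<lambda>_. gauss))"
    if G: "G \<in> borel_measurable (PiM K (\<lambda>_. gauss))" for G :: "_ \<Rightarrow> ennreal"
  proof -
    have [measurable]: "G \<in> borel_measurable (PiM (insert b (insert a L)) (\<lambda>_. gauss))"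
      using G K by simp
    have [measurable]: "(\<lambda>\<omega>. \<integral>\<^sup>+y. G ((\<omega>)(b := y)) \<partial>gauss) \<in> borel_measurable (PiM (insert a L) (\<lambda>_. gauss))"
      by measurable
    show ?thesis
      unfolding K using L
      by (simp add: gauss_product.product_nn_integral_insert)
  qed
  let ?R = "\<lambda>\<omega>. (\<omega>)(a := c * \<omega> a + s * \<omega> b, b := s * \<omega> a - c * \<omega> b)"
  have R: "(\<lambda>\<omega>. F (?R \<omega>)) \<in> borel_measurable (PiM K (\<lambda>_. gauss))"
    using assms by (intro measurable_compose [OF measurable_reflect_pair F])
  show ?thesis
    unfolding iter [OF F] iter [OF R]
  proof (rule nn_integral_cong)
    fix \<omega> assume \<omega>: "\<omega> \<in> space (PiM L (\<lambda>_. gauss))"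
    have "(\<lambda>z. (\<omega>)(a := fst z, b := snd z)) \<in> borel \<Otimes>\<^sub>M borel \<rightarrow>\<^sub>M PiM K (\<lambda>_. gauss)"
    proof (rule measurable_PiM_single')
      fix i assume "i \<in> K"
      show "(\<lambda>z. ((\<omega>)(a := fst z, b := snd z)) i) \<in> borel \<Otimes>\<^sub>M borel \<rightarrow>\<^sub>M gauss"
        by (cases "i = b"; cases "i = a") simp_all
    qed (use \<omega> in \<open>auto simp: K space_PiM PiE_def extensional_def\<close>)
    then have "(\<lambda>z. F ((\<omega>)(a := fst z, b := snd z))) \<in> borel_measurable (borel \<Otimes>\<^sub>M borel)"
      using F by (rule measurable_compose)
    from nn_integral_gauss_pair_reflect [OF this s cs] \<open>a \<noteq> b\<close>
    show "(\<integral>\<^sup>+x. (\<integral>\<^sup>+y. F (?R ((\<omega>)(a := x, b := y))) \<partial>gauss) \<partial>gauss)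
        = (\<integral>\<^sup>+x. (\<integral>\<^sup>+y. F ((\<omega>)(a := x, b := y)) \<partial>gauss) \<partial>gauss)"
      by (simp add: fun_upd_twist)
  qed
qed

text \<open>
  The index \<open>(k, j)\<close> stands for row \<open>k\<close> and column \<open>j\<close>. Rows 1 and \<open>r\<close> are mixed, in the columns \<open>J\<close>.
\<close>
definition reflect_rows :: "real \<Rightarrow> real \<Rightarrow> nat \<Rightarrow> nat set \<Rightarrow> (nat \<times> nat \<Rightarrow> real) \<Rightarrow> nat \<times> nat \<Rightarrow> real" where
  "reflect_rows c s r J \<omega> = (\<lambda>(k, j).
     if j \<in> J \<and> k = 1 then c * \<omega> (1, j) + s * \<omega> (r, j)
     else if j \<in> J \<and> k = r then s * \<omega> (1, j) - c * \<omega> (r, j)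
     else \<omega> (k, j))"

lemma reflect_rows_insert:
  assumes "r \<noteq> 1" "j \<notin> J"
  shows "reflect_rows c s r (insert j J) \<omega> = (reflect_rows c s r J \<omega>)
    ((1, j) := c * reflect_rows c s r J \<omega> (1, j) + s * reflect_rows c s r J \<omega> (r, j),
     (r, j) := s * reflect_rows c s r J \<omega> (1, j) - c * reflect_rows c s r J \<omega> (r, j))"
  using assms by (auto simp: reflect_rows_def fun_eq_iff)

lemma measurable_reflect_rows:
  assumes "finite J" "r \<noteq> 1" "{1, r} \<times> J \<subseteq> K"
  shows "reflect_rows c s r J \<in> PiM K (\<lambda>_. gauss) \<rightarrow>\<^sub>M PiM K (\<lambda>_. gauss)"
  using assms(1,3)
proof (induction J rule: finite_induct)
  case empty
  have "reflect_rows c s r {} = (\<lambda>\<omega>. \<omega>)"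
    by (auto simp: reflect_rows_def fun_eq_iff)
  then show ?case by simp
next
  case (insert j J)
  have "reflect_rows c s r J \<in> PiM K (\<lambda>_. gauss) \<rightarrow>\<^sub>M PiM K (\<lambda>_. gauss)"
    using insert by auto
  moreover have "(1, j) \<in> K" "(r, j) \<in> K"
    using insert.prems by auto
  ultimately show ?case
    by (subst reflect_rows_insert [OF \<open>r \<noteq> 1\<close> insert.hyps(2), abs_def])
       (rule measurable_compose [OF _ measurable_reflect_pair])
qed

lemma nn_integral_reflect_rows:
  assumes "finite J" "r \<noteq> 1" "{1, r} \<times> J \<subseteq> K" "finite K" and s: "0 < s" and cs: "c\<^sup>2 + s\<^sup>2 = 1"
    and "F \<in> borel_measurable (PiM K (\<lambda>_. gauss))"
  shows "(\<integral>\<^sup>+\<omega>. F (reflect_rows c s r J \<omega>) \<partial>PiM K (\<lambda>_. gauss)) = (\<integral>\<^sup>+\<omega>. F \<omega> \<partial>PiM K (\<lambda>_. gauss))"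
  using assms(1,3,7)
proof (induction J arbitrary: F rule: finite_induct)
  case empty
  have "reflect_rows c s r {} = (\<lambda>\<omega>. \<omega>)"
    by (auto simp: reflect_rows_def fun_eq_iff)
  then show ?case by simp
next
  case (insert j J)
  let ?R = "\<lambda>\<omega> :: nat \<times> nat \<Rightarrow> real. (\<omega>)((1, j) := c * \<omega> (1, j) + s * \<omega> (r, j), (r, j) := s * \<omega> (1, j) - c * \<omega> (r, j))"
  have j: "(1, j) \<in> K" "(r, j) \<in> K" "(1, j) \<noteq> (r, j)"
    using insert.prems \<open>r \<noteq> 1\<close> by auto
  have R: "(\<lambda>\<omega>. F (?R \<omega>)) \<in> borel_measurable (PiM K (\<lambda>_. gauss))"
    using j insert.prems(2) by (intro measurable_compose [OF measurable_reflect_pair])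
  have "(\<integral>\<^sup>+\<omega>. F (reflect_rows c s r (insert j J) \<omega>) \<partial>PiM K (\<lambda>_. gauss))
      = (\<integral>\<^sup>+\<omega>. F (?R (reflect_rows c s r J \<omega>)) \<partial>PiM K (\<lambda>_. gauss))"
    by (simp only: reflect_rows_insert [OF \<open>r \<noteq> 1\<close> insert.hyps(2)])
  also have "\<dots> = (\<integral>\<^sup>+\<omega>. F (?R \<omega>) \<partial>PiM K (\<lambda>_. gauss))"
    using insert.prems by (intro insert.IH R) auto
  also have "\<dots> = (\<integral>\<^sup>+\<omega>. F \<omega> \<partial>PiM K (\<lambda>_. gauss))"
    by (rule nn_integral_gauss_product_reflect_pair [OF \<open>finite K\<close> j s cs insert.prems(2)])
  finally show ?case .
qed

section \<open>Hermite polynomials and Mehler's formula\<close>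

text \<open>
  The monic Hermite polynomials. Their products over distinct variables are the Wick products, and
  the factorials in the normalisation of the chaos are absorbed by them.
\<close>
fun hermite_poly :: "nat \<Rightarrow> real poly" where
  "hermite_poly 0 = 1"
| "hermite_poly (Suc 0) = [:0, 1:]"
| "hermite_poly (Suc (Suc k)) = [:0, 1:] * hermite_poly (Suc k) - smult (real (Suc k)) (hermite_poly k)"

lemma poly_hermite_poly: "poly (hermite_poly k) t = fact k * hermite k t"
proof (induction k rule: hermite_poly.induct)
  case (3 k)
  have "fact (Suc (Suc k)) * hermite (Suc (Suc k)) t
      = (real (Suc (Suc k)) * fact (Suc k)) * ((t * hermite (Suc k) t - hermite k t) / real (Suc (Suc k)))"
    by (simp only: fact_Suc of_nat_mult hermite.simps) simp
  also have "\<dots> = fact (Suc k) * (t * hermite (Suc k) t - hermite k t)"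
    by (simp only: times_divide_eq_right) (simp del: of_nat_Suc fact_Suc)
  finally show ?case
    using 3 by (simp add: algebra_simps)
qed simp_all

lemma pderiv_hermite_poly: "pderiv (hermite_poly (Suc k)) = smult (real (Suc k)) (hermite_poly k)"
proof (induction k rule: hermite_poly.induct)
  case (3 k)
  have "pderiv (hermite_poly (Suc (Suc (Suc k)))) =
     hermite_poly (Suc (Suc k)) + [:0, 1:] * pderiv (hermite_poly (Suc (Suc k)))
       - smult (real (Suc (Suc k))) (pderiv (hermite_poly (Suc k)))"
    by (simp only: hermite_poly.simps(3) [of "Suc k"] pderiv_diff pderiv_mult pderiv_smult)
       (simp add: pderiv_pCons algebra_simps)
  also have "\<dots> = hermite_poly (Suc (Suc k)) + smult (real (Suc (Suc k)))
      ([:0, 1:] * hermite_poly (Suc k) - smult (real (Suc k)) (hermite_poly k))"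
    by (simp only: 3) (simp add: algebra_simps smult_diff_right)
  also have "\<dots> = smult (real (Suc (Suc (Suc k)))) (hermite_poly (Suc (Suc k)))"
    by (simp only: hermite_poly.simps(3) [symmetric] of_nat_Suc [of "Suc (Suc k)"] smult_add_left) simp
  finally show ?case .
qed (simp_all add: pderiv_pCons pderiv_diff pderiv_mult)

lemma
  fixes f :: "real \<Rightarrow> real"
  assumes [measurable]: "f \<in> borel_measurable borel"
  shows integrable_gauss_iff: "integrable gauss f \<longleftrightarrow> integrable lborel (\<lambda>y. std_normal_density y * f y)"
    and integral_gauss: "integral\<^sup>L gauss f = integral\<^sup>L lborel (\<lambda>y. std_normal_density y * f y)"
  unfolding gauss_def by (simp_all add: integrable_density integral_density)

lemma integrable_gauss_poly: "integrable gauss (\<lambda>y. poly p y)"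
proof -
  have "integrable gauss (\<lambda>y. y ^ k)" for k
    by (simp add: integrable_gauss_iff integrable_std_normal_moment)
  then show ?thesis
    by (simp add: poly_altdef)
qed

lemma gauss_moment_Suc: "(\<integral>y. y ^ Suc k \<partial>gauss) = real k * (\<integral>y. y ^ (k - 1) \<partial>gauss)"
proof -
  have M: "(\<integral>y. y ^ n \<partial>gauss) = (\<integral>y. std_normal_density y * y ^ n \<partial>lborel)" for n
    by (simp add: integral_gauss)
  have even: "(\<integral>y. y ^ (2 * j) \<partial>gauss) = fact (2 * j) / (2 ^ j * fact j)" for j
    unfolding M by (rule integral_std_normal_moment_even)
  have odd: "(\<integral>y. y ^ (2 * j + 1) \<partial>gauss) = 0" for j
    unfolding M by (rule integral_std_normal_moment_odd)
  show ?thesis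
  proof (cases "even k")
    case True
    then obtain j where k: "k = 2 * j" by blast
    show ?thesis
    proof (cases j)
      case 0
      then show ?thesis using odd [of 0] k by simp
    next
      case (Suc i)
      then have "k - 1 = 2 * i + 1" "Suc k = 2 * j + 1" using k by simp_all
      then show ?thesis by (simp only: odd)
    qed
  next
    case False
    then obtain j where k: "k = 2 * j + 1" using oddE by blast
    then have "Suc k = 2 * Suc j" "k - 1 = 2 * j" by simp_all
    have "fact (2 * Suc j) = (2 * real (Suc j)) * ((2 * real j + 1) * fact (2 * j))"
      "2 ^ Suc j * fact (Suc j) = (2 * real (Suc j)) * (2 ^ j * fact j)"
      by (simp_all add: algebra_simps)
    then have "fact (2 * Suc j) / (2 ^ Suc j * fact (Suc j))
        = (2 * real j + 1) * fact (2 * j) / (2 ^ j * fact j :: real)"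
      by (simp only: mult_divide_mult_cancel_left_if) simp
    then show ?thesis
      unfolding \<open>Suc k = 2 * Suc j\<close> \<open>k - 1 = 2 * j\<close> even by (simp add: k)
  qed
qed

text \<open>
  For monomials this is the recursion of the Gaussian moments, and both sides are linear in \<open>p\<close>.
\<close>
lemma gauss_integration_by_parts:
  "(\<integral>y. y * poly p y \<partial>gauss) = (\<integral>y. poly (pderiv p) y \<partial>gauss)"
proof -
  have monom: "(\<integral>y. y * poly (monom a i) y \<partial>gauss) = (\<integral>y. poly (pderiv (monom a i)) y \<partial>gauss)" for a i
  proof -
    have "(\<integral>y. y * poly (monom a i) y \<partial>gauss) = a * (\<integral>y. y ^ Suc i \<partial>gauss)"
      by (simp add: poly_monom mult.left_commute [of _ a])
    also have "\<dots> = (\<integral>y. poly (pderiv (monom a i)) y \<partial>gauss)"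
      unfolding gauss_moment_Suc by (simp add: pderiv_monom poly_monom mult_ac)
    finally show ?thesis .
  qed
  have int: "integrable gauss (\<lambda>y. y * poly q y)" for q
    using integrable_gauss_poly [of "[:0, 1:] * q"] by simp
  have "(\<integral>y. y * poly (\<Sum>i\<le>n. monom (coeff p i) i) y \<partial>gauss)
      = (\<integral>y. poly (pderiv (\<Sum>i\<le>n. monom (coeff p i) i)) y \<partial>gauss)" for n
  proof (induction n)
    case 0
    show ?case using monom [of _ 0] by simp
  next
    case (Suc n)
    then show ?case
      using monom [of "coeff p (Suc n)" "Suc n"]
      by (simp add: pderiv_add distrib_left int integrable_gauss_poly)
  qed
  from this [of "degree p"] show ?thesis
    unfolding poly_as_sum_of_monoms .
qed

lemma gauss_integral_hermite_shift:
  "(\<integral>y. y * poly (hermite_poly (Suc k)) (a + s * y) \<partial>gauss)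
    = s * real (Suc k) * (\<integral>y. poly (hermite_poly k) (a + s * y) \<partial>gauss)"
  using gauss_integration_by_parts [of "pcompose (hermite_poly (Suc k)) [:a, s:]"]
  by (simp add: pderiv_pcompose pderiv_hermite_poly poly_pcompose pderiv_pCons mult_ac
      del: hermite_poly.simps of_nat_Suc)

lemma integrable_gauss_hermite:
  "integrable gauss (\<lambda>y. poly (hermite_poly k) (a + s * y))"
  "integrable gauss (\<lambda>y. y * poly (hermite_poly k) (a + s * y))"
  using integrable_gauss_poly [of "pcompose (hermite_poly k) [:a, s:]"]
    integrable_gauss_poly [of "[:0, 1:] * pcompose (hermite_poly k) [:a, s:]"]
  by (simp_all add: poly_pcompose mult_ac)

lemma hermite_poly_recurrence:
  "poly (hermite_poly (Suc (Suc k))) t = t * poly (hermite_poly (Suc k)) t - real (Suc k) * poly (hermite_poly k) t"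
  by simp

text \<open>
  Mehler's formula: averaging over the second variable is the Ornstein-Uhlenbeck operator, of which
  the Hermite polynomials are eigenfunctions. In the three-term recursion, integration by parts
  turns the factor \<open>s * y\<close> into \<open>s\<^sup>2\<close>, which combines with the last term to \<open>- c\<^sup>2\<close>.
\<close>
lemma mehler_hermite:
  assumes "c\<^sup>2 + s\<^sup>2 = 1"
  shows "(\<integral>y. poly (hermite_poly k) (c * x + s * y) \<partial>gauss) = c ^ k * poly (hermite_poly k) x"
proof (induction k rule: hermite_poly.induct)
  case 1
  show ?case using gauss.prob_space by simp
next
  case 2
  have "(\<integral>y. y \<partial>gauss) = 0"
    using gauss_moment_Suc [of 0] by simp
  moreover have "integrable gauss (\<lambda>y. y)"
    using integrable_gauss_poly [of "[:0, 1:]"] by simp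
  ultimately show ?case using gauss.prob_space by simp
next
  case (3 k)
  let ?h = "\<lambda>k y. poly (hermite_poly k) (c * x + s * y)"
  have s2: "s * s = 1 - c * c"
    using assms by (simp add: power2_eq_square)
  have "(\<integral>y. ?h (Suc (Suc k)) y \<partial>gauss)
      = (\<integral>y. c * x * ?h (Suc k) y + s * (y * ?h (Suc k) y) - real (Suc k) * ?h k y \<partial>gauss)"
    unfolding hermite_poly_recurrence by (simp only: algebra_simps)
  also have "\<dots> = c * x * (\<integral>y. ?h (Suc k) y \<partial>gauss) + s * (\<integral>y. y * ?h (Suc k) y \<partial>gauss)
      - real (Suc k) * (\<integral>y. ?h k y \<partial>gauss)"
    using integrable_gauss_hermite by (simp del: hermite_poly.simps of_nat_Suc)
  also have "\<dots> = c * x * (\<integral>y. ?h (Suc k) y \<partial>gauss) - c * c * real (Suc k) * (\<integral>y. ?h k y \<partial>gauss)"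
  proof -
    have "s * (\<integral>y. y * ?h (Suc k) y \<partial>gauss) = (s * s) * real (Suc k) * (\<integral>y. ?h k y \<partial>gauss)"
      unfolding gauss_integral_hermite_shift by simp
    then show ?thesis unfolding s2 by (simp add: algebra_simps)
  qed
  also have "\<dots> = c ^ Suc (Suc k) * poly (hermite_poly (Suc (Suc k))) x"
    unfolding 3 hermite_poly_recurrence by (simp add: algebra_simps del: hermite_poly.simps)
  finally show ?case .
qed

text \<open>
  The factor \<open>s * x - c * y\<close> is uncorrelated with \<open>c * x + s * y\<close> if \<open>x\<close> and \<open>y\<close> are independent
  standard Gaussian variables. Its product with the Hermite polynomial is therefore still a Wick
  product, so averaging over \<open>y\<close> merely deletes \<open>y\<close> from it and raises the degree in \<open>x\<close> by one.
\<close>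
lemma mehler_hermite_mult:
  assumes "c\<^sup>2 + s\<^sup>2 = 1"
  shows "(\<integral>y. poly (hermite_poly k) (c * x + s * y) * (s * x - c * y) \<partial>gauss)
    = s * c ^ k * poly (hermite_poly (Suc k)) x"
proof -
  let ?h = "\<lambda>k y. poly (hermite_poly k) (c * x + s * y)"
  have "(\<integral>y. ?h k y * (s * x - c * y) \<partial>gauss) = (\<integral>y. s * x * ?h k y - c * (y * ?h k y) \<partial>gauss)"
    by (simp only: algebra_simps)
  also have "\<dots> = s * x * (\<integral>y. ?h k y \<partial>gauss) - c * (\<integral>y. y * ?h k y \<partial>gauss)"
    using integrable_gauss_hermite by simp
  also have "\<dots> = s * c ^ k * poly (hermite_poly (Suc k)) x"
  proof (cases k)
    case 0
    then show ?thesis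
      using gauss_moment_Suc [of 0] gauss.prob_space by simp
  next
    case (Suc j)
    show ?thesis
      unfolding Suc gauss_integral_hermite_shift mehler_hermite [OF assms] hermite_poly_recurrence
      by (simp add: algebra_simps del: hermite_poly.simps)
  qed
  finally show ?thesis .
qed

section \<open>Hermite polynomials along a line\<close>

text \<open>
  By induction on \<open>m\<close>: replacing \<open>p(t)\<close> by \<open>p(2 t) - 2 ^ (m + 1) * p(t)\<close> removes the coefficient of degree
  \<open>m + 1\<close> and multiplies the linear one by \<open>2 - 2 ^ (m + 1)\<close>, which is nonzero. The nodes are powers of 2
  because then this step maps nodes to nodes.
\<close>
lemma exists_linear_coefficient_functional:
  assumes "1 \<le> m"
  shows "\<exists>w :: nat \<Rightarrow> real. \<forall>p. degree p \<le> m \<longrightarrow> (\<Sum>l\<le>m. w l * poly p (2 ^ l)) = coeff p 1"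
proof -
  have "\<exists>w :: nat \<Rightarrow> real. \<forall>k\<le>m. (\<Sum>l\<le>m. w l * (2 ^ l) ^ k) = (if k = 1 then 1 else 0)"
    using assms
  proof (induction m rule: dec_induct)
    case base
    show ?case
    proof (rule exI [of _ "\<lambda>l. if l = 0 then -1 else 1"], intro allI impI)
      fix k :: nat assume "k \<le> 1"
      then consider "k = 0" | "k = 1" by linarith
      then show "(\<Sum>l\<le>1. (if l = 0 then -1 else 1) * (2 ^ l) ^ k) = (if k = 1 then 1 else 0 :: real)"
        by cases simp_all
    qed
  next
    case (step m)
    then obtain w :: "nat \<Rightarrow> real" where
      w: "\<And>k. k \<le> m \<Longrightarrow> (\<Sum>l\<le>m. w l * (2 ^ l) ^ k) = (if k = 1 then 1 else 0)"
      by blast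
    define D :: real where "D = 2 - 2 ^ Suc m"
    have "D \<noteq> 0"
      using step.hyps power_increasing [of 2 "Suc m" "2 :: real"] by (simp add: D_def)
    define w' where "w' l = ((if l = 0 then 0 else w (l - 1)) - 2 ^ Suc m * (if l \<le> m then w l else 0)) / D" for l
    have sum: "(\<Sum>l\<le>Suc m. w' l * (2 ^ l) ^ k) = (2 ^ k - 2 ^ Suc m) / D * (\<Sum>l\<le>m. w l * (2 ^ l) ^ k)" for k
    proof -
      have 1: "(\<Sum>l\<le>Suc m. (if l = 0 then 0 else w (l - 1)) * (2 ^ l) ^ k) = 2 ^ k * (\<Sum>l\<le>m. w l * (2 ^ l) ^ k)"
        by (subst sum.atMost_Suc_shift) (simp add: sum_distrib_left power_mult_distrib mult_ac)
      have 2: "(\<Sum>l\<le>Suc m. (if l \<le> m then w l else 0) * (2 ^ l) ^ k) = (\<Sum>l\<le>m. w l * (2 ^ l) ^ k)"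
        by simp
      have "D * (\<Sum>l\<le>Suc m. w' l * (2 ^ l) ^ k) =
          (\<Sum>l\<le>Suc m. (if l = 0 then 0 else w (l - 1)) * (2 ^ l) ^ k)
            - 2 ^ Suc m * (\<Sum>l\<le>Suc m. (if l \<le> m then w l else 0) * (2 ^ l) ^ k)"
      proof -
        have "D * (w' l * a) = (if l = 0 then 0 else w (l - 1)) * a - 2 ^ Suc m * ((if l \<le> m then w l else 0) * a)" for l a
        proof -
          have "D * w' l = (if l = 0 then 0 else w (l - 1)) - 2 ^ Suc m * (if l \<le> m then w l else 0)"
            using \<open>D \<noteq> 0\<close> by (simp add: w'_def)
          then show ?thesis
            by (simp only: mult.assoc [symmetric] left_diff_distrib)
        qed
        then show ?thesis
          by (simp only: sum_distrib_left sum_subtractf [symmetric])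
      qed
      then show ?thesis
        unfolding 1 2 using \<open>D \<noteq> 0\<close> by (simp add: field_simps)
    qed
    have "(\<Sum>l\<le>Suc m. w' l * (2 ^ l) ^ k) = (if k = 1 then 1 else 0)" if "k \<le> Suc m" for k
    proof (cases "k = Suc m")
      case True
      then show ?thesis unfolding sum using step.hyps by simp
    next
      case False
      then have "k \<le> m" using that by simp
      then show ?thesis unfolding sum w [OF \<open>k \<le> m\<close>] using \<open>D \<noteq> 0\<close> by (simp add: D_def)
    qed
    then show ?case
      by (intro exI [of _ w']) simp
  qed
  then obtain w :: "nat \<Rightarrow> real" where
    w: "\<And>k. k \<le> m \<Longrightarrow> (\<Sum>l\<le>m. w l * (2 ^ l) ^ k) = (if k = 1 then 1 else 0)"
    by blast
  have "(\<Sum>l\<le>m. w l * poly p (2 ^ l)) = coeff p 1" if "degree p \<le> m" for p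
  proof -
    have "(\<Sum>l\<le>m. w l * poly p (2 ^ l)) = (\<Sum>l\<le>m. \<Sum>k\<le>m. coeff p k * (w l * (2 ^ l) ^ k))"
    proof -
      have "poly p t = (\<Sum>k\<le>m. coeff p k * t ^ k)" for t
        unfolding poly_altdef using that
        by (intro sum.mono_neutral_left) (auto simp: coeff_eq_0)
      then show ?thesis
        by (simp only: sum_distrib_left mult.left_commute)
    qed
    also have "\<dots> = (\<Sum>k\<le>m. coeff p k * (\<Sum>l\<le>m. w l * (2 ^ l) ^ k))"
      by (subst sum.swap) (simp add: sum_distrib_left)
    also have "\<dots> = (\<Sum>k\<le>m. coeff p k * (if k = 1 then 1 else 0))"
      using w by simp
    also have "\<dots> = coeff p 1"
      using assms by (simp add: if_distrib [of "\<lambda>a. _ * a"] sum.delta cong: if_cong)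
    finally show ?thesis .
  qed
  then show ?thesis by blast
qed

text \<open>
  The homogenised Hermite polynomial \<open>sqrt (1 + t\<^sup>2) ^ k * h k ((x + t * y) / sqrt (1 + t\<^sup>2))\<close>, as a
  polynomial in \<open>t\<close>. The recursion is that of \<open>hermite_poly\<close> with the variance \<open>1 + t\<^sup>2\<close> in place of 1.
\<close>
fun line_hermite_poly :: "real \<Rightarrow> real \<Rightarrow> nat \<Rightarrow> real poly" where
  "line_hermite_poly x y 0 = 1"
| "line_hermite_poly x y (Suc 0) = [:x, y:]"
| "line_hermite_poly x y (Suc (Suc k)) =
     [:x, y:] * line_hermite_poly x y (Suc k) - smult (real (Suc k)) ([:1, 0, 1:] * line_hermite_poly x y k)"

lemma poly_line_hermite_poly:
  "poly (line_hermite_poly x y k) t = sqrt (1 + t\<^sup>2) ^ k * poly (hermite_poly k) ((x + t * y) / sqrt (1 + t\<^sup>2))"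
proof (induction k rule: hermite_poly.induct)
  case 1
  show ?case by simp
next
  case 2
  have "sqrt (1 + t\<^sup>2) \<noteq> 0" by (simp add: add_nonneg_eq_0_iff)
  then show ?case by simp
next
  case (3 k)
  let ?r = "sqrt (1 + t\<^sup>2)"
  have r: "?r * ?r = 1 + t\<^sup>2" by (simp add: add_nonneg_nonneg)
  have r0: "?r \<noteq> 0" by (simp add: add_nonneg_eq_0_iff)
  have "poly (line_hermite_poly x y (Suc (Suc k))) t
      = (x + t * y) * poly (line_hermite_poly x y (Suc k)) t - real (Suc k) * ((?r * ?r) * poly (line_hermite_poly x y k) t)"
    unfolding r by (simp add: algebra_simps power2_eq_square)
  also have "\<dots> = ?r ^ Suc (Suc k) * ((x + t * y) / ?r * poly (hermite_poly (Suc k)) ((x + t * y) / ?r)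
      - real (Suc k) * poly (hermite_poly k) ((x + t * y) / ?r))"
  proof -
    have "(x + t * y) * (r ^ Suc k * a) - b * ((r * r) * (r ^ k * d)) = r ^ Suc (Suc k) * ((x + t * y) / r * a - b * d)"
      if "r \<noteq> 0" for r a b d :: real
      using that by (simp add: field_simps)
    from this [OF r0] show ?thesis unfolding 3 .
  qed
  finally show ?case unfolding hermite_poly_recurrence .
qed

lemma degree_line_hermite_poly: "degree (line_hermite_poly x y k) \<le> k"
proof (induction k rule: hermite_poly.induct)
  case (3 k)
  have "degree ([:x, y:] * line_hermite_poly x y (Suc k)) \<le> 1 + Suc k"
    using 3 by (intro order.trans [OF degree_mult_le] add_mono) auto
  moreover have "degree ([:1, 0, 1:] * line_hermite_poly x y k) \<le> 2 + k"
    using 3 by (intro order.trans [OF degree_mult_le] add_mono) auto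
  ultimately show ?case
    by (simp del: mult_pCons_left mult_pCons_right) (intro degree_diff_le order.trans [OF degree_smult_le], auto)
qed auto

lemma coeff_0_line_hermite_poly: "coeff (line_hermite_poly x y k) 0 = poly (hermite_poly k) x"
  using poly_line_hermite_poly [of x y k 0] by (simp add: poly_0_coeff_0)

text \<open>
  The derivative of \<open>h k\<close> is \<open>k\<close> times \<open>h (k - 1)\<close>, and \<open>sqrt (1 + t\<^sup>2)\<close> does not contribute to first
  order. For \<open>k = 0\<close> the truncated \<open>k - 1\<close> is harmless, since the factor \<open>k\<close> vanishes.
\<close>
lemma coeff_1_line_hermite_poly:
  "coeff (line_hermite_poly x y k) 1 = real k * y * poly (hermite_poly (k - 1)) x"
proof (induction k rule: hermite_poly.induct)
  case (3 k)
  have "coeff (line_hermite_poly x y (Suc (Suc k))) 1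
      = x * coeff (line_hermite_poly x y (Suc k)) 1 + y * coeff (line_hermite_poly x y (Suc k)) 0
        - real (Suc k) * coeff (line_hermite_poly x y k) 1"
    by (simp add: coeff_pCons One_nat_def algebra_simps)
  also have "\<dots> = x * (real (Suc k) * y * poly (hermite_poly k) x) + y * poly (hermite_poly (Suc k)) x
      - real (Suc k) * (real k * y * poly (hermite_poly (k - 1)) x)"
    unfolding 3 coeff_0_line_hermite_poly by simp
  also have "\<dots> = real (Suc (Suc k)) * y * poly (hermite_poly (Suc k)) x"
  proof (cases k)
    case (Suc j)
    show ?thesis
      unfolding Suc by (simp add: hermite_poly_recurrence algebra_simps del: hermite_poly.simps)
  qed simp
  finally show ?case by simp
qed simp_all

section \<open>Partially decoupled chaoses\<close>

text \<open>
  The first \<open>k\<close> entries of \<open>is\<close> enter through a Wick product in the variables of row 1, and the entry in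
  each later position through its own row. Rows start at 1 and list positions at 0, so row \<open>l\<close> goes
  with position \<open>l - 1\<close>.
\<close>
definition chaos_coeff :: "nat \<Rightarrow> nat \<Rightarrow> nat \<Rightarrow> nat list \<Rightarrow> (nat \<times> nat \<Rightarrow> real) \<Rightarrow> real" where
  "chaos_coeff m n k is \<omega> = (\<Prod>j\<in>{1..n}. poly (hermite_poly (count_list (take k is) j)) (\<omega> (1, j)))
     * (\<Prod>l\<in>{k+1..m}. \<omega> (l, is ! (l - 1)))"

definition chaos_moment ::
    "real \<Rightarrow> nat \<Rightarrow> nat \<Rightarrow> nat \<Rightarrow> (nat list \<Rightarrow> 'e::real_normed_vector) \<Rightarrow> ennreal" where
  "chaos_moment p m n k x =
     (\<integral>\<^sup>+\<omega>. ennreal (norm (\<Sum>is\<in>multi_indices m n. chaos_coeff m n k is \<omega> *\<^sub>R x is) powr p)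
        \<partial>PiM ({1..m} \<times> {1..n}) (\<lambda>_. gauss))"

lemma finite_multi_indices: "finite (multi_indices m n)"
proof -
  have "multi_indices m n = {is. set is \<subseteq> {1..n} \<and> length is = m}"
    by (auto simp: multi_indices_def)
  then show ?thesis
    using finite_lists_length_eq [of "{1..n}" m] by simp
qed

lemma multi_indices_nth:
  assumes "is \<in> multi_indices m n" "l < m"
  shows "is ! l \<in> {1..n}"
  using assms by (auto simp: multi_indices_def dest!: nth_mem)

lemma sum_count_take:
  assumes "is \<in> multi_indices m n" "k \<le> m"
  shows "(\<Sum>j\<in>{1..n}. count_list (take k is) j) = k"
proof -
  have "set (take k is) \<subseteq> {1..n}"
    using assms(1) set_take_subset [of k "is"] by (auto simp: multi_indices_def)
  from sum_count_set [OF this] show ?thesis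
    using assms by (simp add: multi_indices_def)
qed

lemma count_list_take_Suc:
  assumes "is \<in> multi_indices m n" "k < m"
  shows "count_list (take (Suc k) is) j = count_list (take k is) j + (if j = is ! k then 1 else 0)"
  using assms by (simp add: multi_indices_def take_Suc_conv_app_nth)

lemma borel_measurable_chaos_coeff:
  assumes "is \<in> multi_indices m n" "1 \<le> m"
  shows "chaos_coeff m n k is \<in> borel_measurable (PiM ({1..m} \<times> {1..n}) (\<lambda>_. gauss))"
proof -
  let ?K = "{1..m} \<times> {1..n}"
  have comp: "(\<lambda>\<omega>. \<omega> i) \<in> borel_measurable (PiM ?K (\<lambda>_. gauss))" if "i \<in> ?K" for i
    using measurable_component_singleton [OF that, of "\<lambda>_. gauss"]
    by (simp add: measurable_cong_sets [OF refl sets_gauss])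
  have poly: "(\<lambda>t. poly q t) \<in> borel_measurable borel" for q :: "real poly"
    by (intro borel_measurable_continuous_onI continuous_intros)
  have "is ! (l - 1) \<in> {1..n}" if "l \<in> {k+1..m}" for l
    using multi_indices_nth [OF assms(1), of "l - 1"] that by auto
  then show ?thesis
    unfolding chaos_coeff_def [abs_def] using assms(2)
    by (intro borel_measurable_times borel_measurable_prod measurable_compose [OF _ poly] comp) auto
qed

lemma chaos_coeff_reflect:
  assumes "is \<in> multi_indices m n" "1 \<le> k" "k < m"
  shows "chaos_coeff m n k is (reflect_rows c s (Suc k) {1..n} \<omega>)
    = (\<Prod>j\<in>{1..n}. poly (hermite_poly (count_list (take k is) j)) (c * \<omega> (1, j) + s * \<omega> (Suc k, j)))
      * ((s * \<omega> (1, is ! k) - c * \<omega> (Suc k, is ! k)) * (\<Prod>l\<in>{Suc k+1..m}. \<omega> (l, is ! (l - 1))))"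
proof -
  let ?\<omega> = "reflect_rows c s (Suc k) {1..n} \<omega>"
  have "(\<Prod>l\<in>{k+1..m}. ?\<omega> (l, is ! (l - 1)))
      = ?\<omega> (Suc k, is ! k) * (\<Prod>l\<in>{Suc k+1..m}. ?\<omega> (l, is ! (l - 1)))"
    using assms(3) by (subst prod.atLeast_Suc_atMost) auto
  also have "?\<omega> (Suc k, is ! k) = s * \<omega> (1, is ! k) - c * \<omega> (Suc k, is ! k)"
    using multi_indices_nth [OF assms(1,3)] assms(2) by (simp add: reflect_rows_def)
  also have "(\<Prod>l\<in>{Suc k+1..m}. ?\<omega> (l, is ! (l - 1))) = (\<Prod>l\<in>{Suc k+1..m}. \<omega> (l, is ! (l - 1)))"
    by (intro prod.cong) (auto simp: reflect_rows_def)
  finally show ?thesis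
    unfolding chaos_coeff_def by (simp add: reflect_rows_def)
qed

text \<open>
  Row \<open>k + 1\<close> enters the reflected coefficient through independent variables in the columns, so the
  integral factorises. The column of \<open>is ! k\<close> carries the extra factor \<open>s x - c y\<close> and contributes \<open>s\<close>
  and one more degree, by \<open>mehler_hermite_mult\<close>; every column \<open>j\<close> contributes \<open>c\<close> to the power of its
  multiplicity, and these multiplicities add up to \<open>k\<close>.
\<close>
lemma integral_chaos_coeff_reflect:
  assumes "is": "is \<in> multi_indices m n" and k: "1 \<le> k" "k < m" and cs: "c\<^sup>2 + s\<^sup>2 = 1"
    and I: "I = {1..m} \<times> {1..n} - {Suc k} \<times> {1..n}" and J: "J = {Suc k} \<times> {1..n}"
  shows "has_bochner_integral (PiM J (\<lambda>_. gauss))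
    (\<lambda>\<eta>. chaos_coeff m n k is (reflect_rows c s (Suc k) {1..n} (merge I J (\<omega>, \<eta>))))
    (s * c ^ k * chaos_coeff m n (Suc k) is (merge I J (\<omega>, \<eta>\<^sub>0)))"
proof -
  let ?j = "is ! k"
  let ?N = "count_list (take k is)"
  let ?rest = "\<Prod>l\<in>{Suc k+1..m}. \<omega> (l, is ! (l - 1))"
  \<comment> \<open>The factor contributed by each variable of row \<open>k + 1\<close>.\<close>
  define f :: "nat \<times> nat \<Rightarrow> real \<Rightarrow> real" where
    "f = (\<lambda>(_, j) y. poly (hermite_poly (?N j)) (c * \<omega> (1, j) + s * y) * (if j = ?j then s * \<omega> (1, j) - c * y else 1))"
  have j: "?j \<in> {1..n}"
    using multi_indices_nth [OF "is" k(2)] .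
  have prod_J: "(\<Prod>i\<in>J. g i) = (\<Prod>j\<in>{1..n}. g (Suc k, j))" for g :: "nat \<times> nat \<Rightarrow> real"
  proof -
    have "J = Pair (Suc k) ` {1..n}" by (auto simp: J)
    then show ?thesis by (simp add: prod.reindex inj_on_def)
  qed
  have row1: "merge I J (\<omega>, \<eta>) (1, j) = \<omega> (1, j)" if "j \<in> {1..n}" for \<eta> j
    using that k by (auto simp: merge_def I)
  have rowk: "merge I J (\<omega>, \<eta>) (Suc k, j) = \<eta> (Suc k, j)" if "j \<in> {1..n}" for \<eta> j
    using that k by (auto simp: merge_def I J)
  have rest: "(\<Prod>l\<in>{Suc k+1..m}. merge I J (\<omega>, \<eta>) (l, is ! (l - 1))) = ?rest" for \<eta>
  proof (intro prod.cong refl)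
    fix l assume l: "l \<in> {Suc k+1..m}"
    then have "is ! (l - 1) \<in> {1..n}"
      using multi_indices_nth [OF "is", of "l - 1"] by auto
    with l show "merge I J (\<omega>, \<eta>) (l, is ! (l - 1)) = \<omega> (l, is ! (l - 1))"
      by (auto simp: merge_def I)
  qed
  have eq: "chaos_coeff m n k is (reflect_rows c s (Suc k) {1..n} (merge I J (\<omega>, \<eta>)))
      = ?rest * (\<Prod>i\<in>J. f i (\<eta> i))" for \<eta>
  proof -
    have "(\<Prod>i\<in>J. f i (\<eta> i)) = (\<Prod>j\<in>{1..n}. poly (hermite_poly (?N j)) (c * \<omega> (1, j) + s * \<eta> (Suc k, j)))
        * (\<Prod>j\<in>{1..n}. if j = ?j then s * \<omega> (1, j) - c * \<eta> (Suc k, j) else 1)"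
      unfolding prod_J f_def by (simp add: prod.distrib)
    also have "(\<Prod>j\<in>{1..n}. if j = ?j then s * \<omega> (1, j) - c * \<eta> (Suc k, j) else 1)
        = s * \<omega> (1, ?j) - c * \<eta> (Suc k, ?j)"
      using j by simp
    finally have "(\<Prod>i\<in>J. f i (\<eta> i))
        = (\<Prod>j\<in>{1..n}. poly (hermite_poly (?N j)) (c * \<omega> (1, j) + s * \<eta> (Suc k, j)))
          * (s * \<omega> (1, ?j) - c * \<eta> (Suc k, ?j))" .
    moreover have "(\<Prod>j\<in>{1..n}. poly (hermite_poly (?N j)) (c * merge I J (\<omega>, \<eta>) (1, j) + s * merge I J (\<omega>, \<eta>) (Suc k, j)))
        = (\<Prod>j\<in>{1..n}. poly (hermite_poly (?N j)) (c * \<omega> (1, j) + s * \<eta> (Suc k, j)))"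
      by (intro prod.cong refl) (simp only: row1 rowk)
    ultimately show ?thesis
      unfolding chaos_coeff_reflect [OF "is" k] rest row1 [OF j] rowk [OF j] by (simp only: mult_ac)
  qed
  have f_eq: "f (l, j) = (\<lambda>y. poly (if j = ?j then [:s * \<omega> (1, j), - c:] * pcompose (hermite_poly (?N j)) [:c * \<omega> (1, j), s:]
      else pcompose (hermite_poly (?N j)) [:c * \<omega> (1, j), s:]) y)" for l j
    by (auto simp: f_def poly_pcompose fun_eq_iff algebra_simps)
  have int: "integrable gauss (f i)" for i
    by (cases i) (simp only: f_eq integrable_gauss_poly)
  have val: "(\<integral>y. f (l, j) y \<partial>gauss)
      = c ^ ?N j * (if j = ?j then s else 1) * poly (hermite_poly (count_list (take (Suc k) is) j)) (\<omega> (1, j))" for l j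
  proof (cases "j = ?j")
    case True
    then show ?thesis
      using mehler_hermite_mult [OF cs, of "?N j" "\<omega> (1, j)"] count_list_take_Suc [OF "is" k(2), of j]
      by (simp add: f_def)
  next
    case False
    then show ?thesis
      using mehler_hermite [OF cs, of "?N j" "\<omega> (1, j)"] count_list_take_Suc [OF "is" k(2), of j]
      by (simp add: f_def)
  qed
  have fin: "finite J" by (simp add: J)
  have "(\<integral>\<eta>. (\<Prod>i\<in>J. f i (\<eta> i)) \<partial>PiM J (\<lambda>_. gauss)) = (\<Prod>i\<in>J. \<integral>y. f i y \<partial>gauss)"
    by (rule gauss_product.product_integral_prod [OF fin int])
  also have "\<dots> = (\<Prod>j\<in>{1..n}. c ^ ?N j) * (\<Prod>j\<in>{1..n}. if j = ?j then s else 1)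
      * (\<Prod>j\<in>{1..n}. poly (hermite_poly (count_list (take (Suc k) is) j)) (\<omega> (1, j)))"
    unfolding prod_J val by (simp add: prod.distrib)
  also have "(\<Prod>j\<in>{1..n}. c ^ ?N j) = c ^ k"
    using sum_count_take [OF "is", of k] k by (simp flip: power_sum)
  also have "(\<Prod>j\<in>{1..n}. if j = ?j then s else 1) = s"
    using j by simp
  finally have integral: "(\<integral>\<eta>. (\<Prod>i\<in>J. f i (\<eta> i)) \<partial>PiM J (\<lambda>_. gauss))
      = c ^ k * s * (\<Prod>j\<in>{1..n}. poly (hermite_poly (count_list (take (Suc k) is) j)) (\<omega> (1, j)))" .
  have target: "chaos_coeff m n (Suc k) is (merge I J (\<omega>, \<eta>\<^sub>0))
      = (\<Prod>j\<in>{1..n}. poly (hermite_poly (count_list (take (Suc k) is) j)) (\<omega> (1, j))) * ?rest"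
  proof -
    have "(\<Prod>j\<in>{1..n}. poly (hermite_poly (count_list (take (Suc k) is) j)) (merge I J (\<omega>, \<eta>\<^sub>0) (1, j)))
        = (\<Prod>j\<in>{1..n}. poly (hermite_poly (count_list (take (Suc k) is) j)) (\<omega> (1, j)))"
      by (intro prod.cong refl) (simp only: row1)
    then show ?thesis
      unfolding chaos_coeff_def rest by (simp only:)
  qed
  show ?thesis
    unfolding has_bochner_integral_iff eq target
    using gauss_product.product_integrable_prod [OF fin int] integral
    by (simp add: mult_ac)
qed

text \<open>
  Reflecting with \<open>c = s = 1 / sqrt 2\<close> leaves the moment of order \<open>k\<close> unchanged, and conditioning on the
  rows other than \<open>k + 1\<close> produces \<open>s * c ^ k = 1 / sqrt 2 ^ (k + 1)\<close> times the sum of order \<open>k + 1\<close>.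
\<close>
lemma chaos_moment_Suc_le:
  fixes x :: "nat list \<Rightarrow> 'e::real_normed_vector"
  assumes p: "1 < p" and k: "1 \<le> k" "k < m"
  shows "chaos_moment p m n (Suc k) x \<le> ennreal ((sqrt 2 ^ Suc k) powr p) * chaos_moment p m n k x"
proof -
  let ?A = "multi_indices m n"
  let ?c = "1 / sqrt 2 :: real"
  let ?d = "?c * ?c ^ k"
  define I where "I = {1..m} \<times> {1..n} - {Suc k} \<times> {1..n}"
  define J where "J = {Suc k} \<times> {1..n}"
  let ?K = "{1..m} \<times> {1..n}"
  let ?R = "reflect_rows ?c ?c (Suc k) {1..n}"
  have K: "I \<union> J = ?K"
    using k by (auto simp: I_def J_def)
  have fin: "finite I" "finite J" "I \<inter> J = {}"
    by (auto simp: I_def J_def)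
  have cs: "?c\<^sup>2 + ?c\<^sup>2 = 1"
    by (simp add: power_divide)
  have rows: "{1, Suc k} \<times> {1..n} \<subseteq> ?K"
    using k by auto
  have R: "?R \<in> PiM ?K (\<lambda>_. gauss) \<rightarrow>\<^sub>M PiM ?K (\<lambda>_. gauss)"
    using k by (intro measurable_reflect_rows rows) auto
  have coeff: "chaos_coeff m n l is \<in> borel_measurable (PiM ?K (\<lambda>_. gauss))" if "is \<in> ?A" for l "is"
    using k by (intro borel_measurable_chaos_coeff that) auto
  have "(\<integral>\<^sup>+\<omega>. ennreal (norm (\<Sum>is\<in>?A. (?d * chaos_coeff m n (Suc k) is \<omega>) *\<^sub>R x is) powr p) \<partial>PiM (I \<union> J) (\<lambda>_. gauss))
      \<le> (\<integral>\<^sup>+\<omega>. ennreal (norm (\<Sum>is\<in>?A. chaos_coeff m n k is (?R \<omega>) *\<^sub>R x is) powr p) \<partial>PiM (I \<union> J) (\<lambda>_. gauss))"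
  proof (rule nn_integral_conditional_jensen [OF p finite_multi_indices fin])
    show "(\<lambda>\<omega>. chaos_coeff m n k is (?R \<omega>)) \<in> borel_measurable (PiM (I \<union> J) (\<lambda>_. gauss))" if "is \<in> ?A" for "is"
      unfolding K by (rule measurable_compose [OF R coeff [OF that]])
    show "(\<lambda>\<omega>. ?d * chaos_coeff m n (Suc k) is \<omega>) \<in> borel_measurable (PiM (I \<union> J) (\<lambda>_. gauss))" if "is \<in> ?A" for "is"
      unfolding K using coeff [OF that] by measurable
    show "has_bochner_integral (PiM J (\<lambda>_. gauss)) (\<lambda>\<eta>'. chaos_coeff m n k is (?R (merge I J (\<omega>, \<eta>'))))
        (?d * chaos_coeff m n (Suc k) is (merge I J (\<omega>, \<eta>)))" if "is \<in> ?A" for "is" \<omega> \<eta>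
      by (rule integral_chaos_coeff_reflect [OF that k cs I_def J_def])
  qed
  also have "\<dots> = chaos_moment p m n k x"
    unfolding K chaos_moment_def using k
    by (intro nn_integral_reflect_rows [of "{1..n}" "Suc k" ?K ?c ?c "\<lambda>\<omega>. ennreal (norm (\<Sum>is\<in>?A. chaos_coeff m n k is \<omega> *\<^sub>R x is) powr p)"]
        rows cs borel_measurable_norm_combination_powr coeff) auto
  finally have le: "(\<integral>\<^sup>+\<omega>. ennreal (norm (\<Sum>is\<in>?A. (?d * chaos_coeff m n (Suc k) is \<omega>) *\<^sub>R x is) powr p) \<partial>PiM ?K (\<lambda>_. gauss))
      \<le> chaos_moment p m n k x"
    unfolding K .
  let ?S = "\<lambda>\<omega>. \<Sum>is\<in>?A. chaos_coeff m n (Suc k) is \<omega> *\<^sub>R x is"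
  have r: "sqrt 2 ^ Suc k * ?d = 1"
    by (simp add: power_divide)
  have "chaos_moment p m n (Suc k) x
      = (\<integral>\<^sup>+\<omega>. ennreal ((sqrt 2 ^ Suc k) powr p) * ennreal (norm (\<Sum>is\<in>?A. (?d * chaos_coeff m n (Suc k) is \<omega>) *\<^sub>R x is) powr p) \<partial>PiM ?K (\<lambda>_. gauss))"
    unfolding chaos_moment_def
  proof (intro nn_integral_cong)
    fix \<omega>
    have "?S \<omega> = (sqrt 2 ^ Suc k) *\<^sub>R (\<Sum>is\<in>?A. (?d * chaos_coeff m n (Suc k) is \<omega>) *\<^sub>R x is)"
    proof -
      have "sqrt 2 ^ Suc k * (?d * a) = a" for a
        using arg_cong [OF r, of "\<lambda>b. b * a"] by (simp only: mult.assoc mult_1_left)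
      then show ?thesis
        by (simp only: scaleR_sum_right scaleR_scaleR)
    qed
    then have "norm (?S \<omega>) = sqrt 2 ^ Suc k * norm (\<Sum>is\<in>?A. (?d * chaos_coeff m n (Suc k) is \<omega>) *\<^sub>R x is)"
      by (simp only: norm_scaleR) simp
    then show "ennreal (norm (?S \<omega>) powr p) = ennreal ((sqrt 2 ^ Suc k) powr p)
        * ennreal (norm (\<Sum>is\<in>?A. (?d * chaos_coeff m n (Suc k) is \<omega>) *\<^sub>R x is) powr p)"
      by (simp only: powr_mult) (simp add: ennreal_mult)
  qed
  also have "\<dots> = ennreal ((sqrt 2 ^ Suc k) powr p)
      * (\<integral>\<^sup>+\<omega>. ennreal (norm (\<Sum>is\<in>?A. (?d * chaos_coeff m n (Suc k) is \<omega>) *\<^sub>R x is) powr p) \<partial>PiM ?K (\<lambda>_. gauss))"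
    using coeff by (intro nn_integral_cmult borel_measurable_norm_combination_powr borel_measurable_times) auto
  also have "\<dots> \<le> ennreal ((sqrt 2 ^ Suc k) powr p) * chaos_moment p m n k x"
    by (intro mult_left_mono le) simp
  finally show ?thesis .
qed

section \<open>Separating one more factor\<close>

lemma coeff_1_prod:
  fixes f :: "'a \<Rightarrow> real poly"
  shows "coeff (\<Prod>j\<in>J. f j) 1 = (\<Sum>j\<in>J. coeff (f j) 1 * (\<Prod>i\<in>J - {j}. coeff (f i) 0))"
proof -
  have d: "coeff q 1 = poly (pderiv q) 0" for q :: "real poly"
    by (simp add: poly_0_coeff_0 coeff_pderiv)
  show ?thesis
    unfolding d pderiv_prod by (simp add: poly_sum poly_prod mult.commute flip: poly_0_coeff_0)
qed

lemma sum_count_list_mult: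
  fixes g :: "'a \<Rightarrow> real"
  assumes "finite X" "set xs \<subseteq> X"
  shows "(\<Sum>a\<in>X. real (count_list xs a) * g a) = (\<Sum>l<length xs. g (xs ! l))"
proof -
  have "(\<Sum>a\<in>X. real (count_list xs a) * g a) = sum_list (map g xs)"
    using assms(2)
  proof (induction xs)
    case (Cons b xs)
    have "(\<Sum>a\<in>X. real (count_list (b # xs) a) * g a)
        = (\<Sum>a\<in>X. real (count_list xs a) * g a + (if a = b then g a else 0))"
      by (intro sum.cong) (auto simp: algebra_simps)
    then show ?case
      using Cons assms(1) by (simp add: sum.distrib)
  qed simp
  then show ?thesis
    by (simp add: sum_list_sum_nth atLeast0LessThan)
qed

text \<open>
  The Wick product of the row-1 variables at the first \<open>k + 1\<close> entries of \<open>is\<close>, except that the factor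
  at position \<open>l\<close> is taken from row \<open>k + 1\<close> instead and is kept as an ordinary factor. For \<open>l \<le> k\<close> the
  column \<open>is ! l\<close> occurs among these entries, and the natural number subtraction is exact.
\<close>
definition marked_coeff :: "nat \<Rightarrow> nat \<Rightarrow> nat list \<Rightarrow> nat \<Rightarrow> (nat \<times> nat \<Rightarrow> real) \<Rightarrow> real" where
  "marked_coeff n k is l \<omega> = \<omega> (Suc k, is ! l)
    * (\<Prod>j\<in>{1..n}. poly (hermite_poly (count_list (take (Suc k) is) j - (if j = is ! l then 1 else 0))) (\<omega> (1, j)))"

text \<open>
  By the product rule the linear coefficient is a sum over columns weighted by their multiplicity in
  the first \<open>k + 1\<close> entries; counting each column with its multiplicity is the same as summing over
  positions.
\<close>
lemma coeff_1_prod_line_hermite: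
  assumes "is": "is \<in> multi_indices m n" and k: "k < m"
  shows "coeff (\<Prod>j\<in>{1..n}. line_hermite_poly (\<omega> (1, j)) (\<omega> (Suc k, j)) (count_list (take (Suc k) is) j)) 1
    = (\<Sum>l\<le>k. marked_coeff n k is l \<omega>)"
proof -
  let ?N = "count_list (take (Suc k) is)"
  let ?h = "\<lambda>N j. poly (hermite_poly N) (\<omega> (1, j))"
  define g where "g a = \<omega> (Suc k, a) * (\<Prod>j\<in>{1..n}. ?h (?N j - (if j = a then 1 else 0)) j)" for a
  have set: "set (take (Suc k) is) \<subseteq> {1..n}"
    using "is" set_take_subset [of "Suc k" "is"] by (auto simp: multi_indices_def)
  have len: "length (take (Suc k) is) = Suc k"
    using "is" k by (simp add: multi_indices_def)
  have "coeff (\<Prod>j\<in>{1..n}. line_hermite_poly (\<omega> (1, j)) (\<omega> (Suc k, j)) (?N j)) 1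
      = (\<Sum>a\<in>{1..n}. real (?N a) * g a)"
    unfolding coeff_1_prod coeff_0_line_hermite_poly coeff_1_line_hermite_poly
  proof (intro sum.cong refl)
    fix a assume a: "a \<in> {1..n}"
    have "(\<Prod>j\<in>{1..n}. ?h (?N j - (if j = a then 1 else 0)) j) = ?h (?N a - 1) a * (\<Prod>j\<in>{1..n} - {a}. ?h (?N j) j)"
      by (subst prod.remove [OF _ a]) (auto intro!: prod.cong)
    then show "real (?N a) * \<omega> (Suc k, a) * ?h (?N a - 1) a * (\<Prod>j\<in>{1..n} - {a}. ?h (?N j) j) = real (?N a) * g a"
      by (simp add: g_def)
  qed
  also have "\<dots> = (\<Sum>l<Suc k. g (take (Suc k) is ! l))"
    using sum_count_list_mult [OF _ set, of g] len by simp
  also have "\<dots> = (\<Sum>l\<le>k. marked_coeff n k is l \<omega>)"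
    unfolding lessThan_Suc_atMost by (intro sum.cong) (auto simp: g_def marked_coeff_def)
  finally show ?thesis .
qed

text \<open>
  Exchanging the entries at positions \<open>l\<close> and \<open>k\<close> permutes the multi-indices, preserves \<open>x\<close> by symmetry,
  and moves the marked position to \<open>k\<close>, where the marked coefficient is \<open>chaos_coeff\<close> of order \<open>k\<close>.
\<close>
lemma sum_marked_coeff:
  fixes x :: "nat list \<Rightarrow> 'e::real_normed_vector"
  assumes sym: "symmetric_family m x" and l: "l \<le> k" and k: "k < m"
  shows "(\<Sum>is\<in>multi_indices m n. (marked_coeff n k is l \<omega> * (\<Prod>i\<in>{Suc k+1..m}. \<omega> (i, is ! (i - 1)))) *\<^sub>R x is)
    = (\<Sum>is\<in>multi_indices m n. chaos_coeff m n k is \<omega> *\<^sub>R x is)"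
proof -
  define \<sigma> :: "nat list \<Rightarrow> nat list" where "\<sigma> is = is[l := is ! k, k := is ! l]" for "is"
  have \<sigma>_mset: "mset (\<sigma> is) = mset is" if "length is = m" for "is"
    using mset_swap [of k "is" l] that l k by (simp add: \<sigma>_def)
  have \<sigma>_set: "set (\<sigma> is) = set is" if "length is = m" for "is"
    using \<sigma>_mset [OF that] by (rule mset_eq_setD)
  have \<sigma>_in: "\<sigma> is \<in> multi_indices m n" if "is \<in> multi_indices m n" for "is"
    using that \<sigma>_set [of "is"] by (auto simp: multi_indices_def \<sigma>_def)
  have \<sigma>_\<sigma>: "\<sigma> (\<sigma> is) = is" if "is \<in> multi_indices m n" for "is"
    using that l k by (intro nth_equalityI) (auto simp: \<sigma>_def multi_indices_def nth_list_update)
  have summand: "(marked_coeff n k is l \<omega> * (\<Prod>i\<in>{Suc k+1..m}. \<omega> (i, is ! (i - 1)))) *\<^sub>R x is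
      = chaos_coeff m n k (\<sigma> is) \<omega> *\<^sub>R x (\<sigma> is)" if "is": "is \<in> multi_indices m n" for "is"
  proof -
    have len: "length is = m" "set is \<subseteq> {1..}"
      using "is" by (auto simp: multi_indices_def)
    have x: "x (\<sigma> is) = x is"
      using sym len \<sigma>_mset [OF len(1)] by (metis symmetric_family_def)
    have nth_k: "\<sigma> is ! k = is ! l"
      using len l k by (simp add: \<sigma>_def)
    have nth_gt: "\<sigma> is ! i = is ! i" if "k < i" for i
      using that l by (simp add: \<sigma>_def)
    have take: "take (Suc k) (\<sigma> is) = (take (Suc k) is)[l := take (Suc k) is ! k, k := take (Suc k) is ! l]"
      using l by (simp add: \<sigma>_def take_update_swap)
    have "mset (take (Suc k) (\<sigma> is)) = mset (take (Suc k) is)"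
      unfolding take using l k len by (intro mset_swap) auto
    then have count: "count_list (take (Suc k) (\<sigma> is)) j = count_list (take (Suc k) is) j" for j
      by (metis count_mset)
    have count': "count_list (take k (\<sigma> is)) j = count_list (take (Suc k) is) j - (if j = is ! l then 1 else 0)" for j
      using count_list_take_Suc [OF \<sigma>_in [OF "is"] k, of j] by (simp add: count nth_k)
    have "(\<Prod>i\<in>{k+1..m}. \<omega> (i, \<sigma> is ! (i - 1))) = \<omega> (Suc k, \<sigma> is ! k) * (\<Prod>i\<in>{Suc k+1..m}. \<omega> (i, \<sigma> is ! (i - 1)))"
      using k by (subst prod.atLeast_Suc_atMost) auto
    also have "(\<Prod>i\<in>{Suc k+1..m}. \<omega> (i, \<sigma> is ! (i - 1))) = (\<Prod>i\<in>{Suc k+1..m}. \<omega> (i, is ! (i - 1)))"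
      by (intro prod.cong refl) (auto simp: nth_gt)
    finally show ?thesis
      unfolding chaos_coeff_def marked_coeff_def x count' nth_k by (simp add: mult_ac)
  qed
  show ?thesis
    by (rule sum.reindex_bij_witness [where i = \<sigma> and j = \<sigma>]) (use \<sigma>_in \<sigma>_\<sigma> summand in auto)
qed

text \<open>
  The power of \<open>r\<close> distributes over the columns because their multiplicities add up to \<open>k + 1\<close>; each
  column then becomes a homogenised Hermite polynomial in \<open>t\<close>.
\<close>
lemma chaos_coeff_Suc_reflect:
  assumes "is": "is \<in> multi_indices m n" and k: "1 \<le> k" "k < m" and r: "r = sqrt (1 + t\<^sup>2)"
  shows "r ^ Suc k * chaos_coeff m n (Suc k) is (reflect_rows (1 / r) (t / r) (Suc k) {1..n} \<omega>)
    = poly (\<Prod>j\<in>{1..n}. line_hermite_poly (\<omega> (1, j)) (\<omega> (Suc k, j)) (count_list (take (Suc k) is) j)) t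
      * (\<Prod>i\<in>{Suc k+1..m}. \<omega> (i, is ! (i - 1)))"
proof -
  let ?\<omega> = "reflect_rows (1 / r) (t / r) (Suc k) {1..n} \<omega>"
  let ?N = "count_list (take (Suc k) is)"
  have "(\<Prod>i\<in>{Suc k+1..m}. ?\<omega> (i, is ! (i - 1))) = (\<Prod>i\<in>{Suc k+1..m}. \<omega> (i, is ! (i - 1)))"
    by (intro prod.cong refl) (auto simp: reflect_rows_def)
  moreover have "r ^ Suc k * (\<Prod>j\<in>{1..n}. poly (hermite_poly (?N j)) (?\<omega> (1, j)))
      = (\<Prod>j\<in>{1..n}. poly (line_hermite_poly (\<omega> (1, j)) (\<omega> (Suc k, j)) (?N j)) t)"
  proof -
    have "r ^ Suc k = (\<Prod>j\<in>{1..n}. r ^ ?N j)"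
      using sum_count_take [OF "is", of "Suc k"] k by (simp flip: power_sum)
    then have "r ^ Suc k * (\<Prod>j\<in>{1..n}. poly (hermite_poly (?N j)) (?\<omega> (1, j)))
        = (\<Prod>j\<in>{1..n}. r ^ ?N j * poly (hermite_poly (?N j)) (?\<omega> (1, j)))"
      by (simp only: prod.distrib)
    also have "\<dots> = (\<Prod>j\<in>{1..n}. poly (line_hermite_poly (\<omega> (1, j)) (\<omega> (Suc k, j)) (?N j)) t)"
    proof (intro prod.cong refl)
      fix j assume "j \<in> {1..n}"
      then have "?\<omega> (1, j) = (\<omega> (1, j) + t * \<omega> (Suc k, j)) / r"
        by (simp add: reflect_rows_def add_divide_distrib)
      then show "r ^ ?N j * poly (hermite_poly (?N j)) (?\<omega> (1, j))
          = poly (line_hermite_poly (\<omega> (1, j)) (\<omega> (Suc k, j)) (?N j)) t"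
        unfolding poly_line_hermite_poly r by (simp only:)
    qed
    finally show ?thesis .
  qed
  ultimately show ?thesis
    unfolding chaos_coeff_def poly_prod by (simp only: mult.assoc [symmetric])
qed

text \<open>
  The sum of order \<open>k\<close> is recovered from reflected copies of the sum of order \<open>k + 1\<close>: the weights \<open>w\<close>
  extract the linear coefficient in \<open>t\<close>, which consists of \<open>k + 1\<close> marked sums that all agree.
\<close>
lemma chaos_eq_sum_reflected:
  fixes x :: "nat list \<Rightarrow> 'e::real_normed_vector"
  assumes sym: "symmetric_family m x" and k: "1 \<le> k" "k < m"
    and w: "\<And>q. degree q \<le> Suc k \<Longrightarrow> (\<Sum>l\<le>Suc k. w l * poly q (2 ^ l)) = coeff q 1"
    and r: "\<And>l. r l = sqrt (1 + (2 ^ l)\<^sup>2)"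
  shows "real (Suc k) *\<^sub>R (\<Sum>is\<in>multi_indices m n. chaos_coeff m n k is \<omega> *\<^sub>R x is)
    = (\<Sum>l\<le>Suc k. (w l * r l ^ Suc k) *\<^sub>R (\<Sum>is\<in>multi_indices m n.
        chaos_coeff m n (Suc k) is (reflect_rows (1 / r l) (2 ^ l / r l) (Suc k) {1..n} \<omega>) *\<^sub>R x is))"
proof -
  let ?A = "multi_indices m n"
  let ?R = "\<lambda>l. reflect_rows (1 / r l) (2 ^ l / r l) (Suc k) {1..n} \<omega>"
  let ?rest = "\<lambda>is. \<Prod>i\<in>{Suc k+1..m}. \<omega> (i, is ! (i - 1))"
  have scalar: "(\<Sum>l\<le>Suc k. w l * r l ^ Suc k * chaos_coeff m n (Suc k) is (?R l))
      = (\<Sum>l\<le>k. marked_coeff n k is l \<omega> * ?rest is)" if "is": "is \<in> ?A" for "is"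
  proof -
    let ?q = "\<Prod>j\<in>{1..n}. line_hermite_poly (\<omega> (1, j)) (\<omega> (Suc k, j)) (count_list (take (Suc k) is) j)"
    have "degree ?q \<le> (\<Sum>j\<in>{1..n}. degree (line_hermite_poly (\<omega> (1, j)) (\<omega> (Suc k, j)) (count_list (take (Suc k) is) j)))"
      using degree_prod_sum_le [of "{1..n}"] by (simp add: o_def)
    also have "\<dots> \<le> (\<Sum>j\<in>{1..n}. count_list (take (Suc k) is) j)"
      by (intro sum_mono degree_line_hermite_poly)
    also have "\<dots> = Suc k"
      using sum_count_take [OF "is", of "Suc k"] k by simp
    finally have deg: "degree ?q \<le> Suc k" .
    have "(\<Sum>l\<le>Suc k. w l * r l ^ Suc k * chaos_coeff m n (Suc k) is (?R l))
        = (\<Sum>l\<le>Suc k. w l * poly ?q (2 ^ l)) * ?rest is"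
      unfolding sum_distrib_right mult.assoc chaos_coeff_Suc_reflect [OF "is" k r] ..
    also have "\<dots> = (\<Sum>l\<le>k. marked_coeff n k is l \<omega>) * ?rest is"
      unfolding w [OF deg] coeff_1_prod_line_hermite [OF "is" k(2)] ..
    finally show ?thesis
      by (simp only: sum_distrib_right)
  qed
  have "(\<Sum>l\<le>Suc k. (w l * r l ^ Suc k) *\<^sub>R (\<Sum>is\<in>?A. chaos_coeff m n (Suc k) is (?R l) *\<^sub>R x is))
      = (\<Sum>is\<in>?A. (\<Sum>l\<le>Suc k. w l * r l ^ Suc k * chaos_coeff m n (Suc k) is (?R l)) *\<^sub>R x is)"
    unfolding scaleR_sum_right scaleR_sum_left scaleR_scaleR by (rule sum.swap)
  also have "\<dots> = (\<Sum>is\<in>?A. (\<Sum>l\<le>k. marked_coeff n k is l \<omega> * ?rest is) *\<^sub>R x is)"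
    by (intro sum.cong refl) (simp only: scalar)
  also have "\<dots> = (\<Sum>l\<le>k. \<Sum>is\<in>?A. (marked_coeff n k is l \<omega> * ?rest is) *\<^sub>R x is)"
    unfolding scaleR_sum_left by (rule sum.swap)
  also have "\<dots> = (\<Sum>l\<le>k. \<Sum>is\<in>?A. chaos_coeff m n k is \<omega> *\<^sub>R x is)"
    by (rule sum.cong [OF refl], rule sum_marked_coeff [OF sym _ k(2)]) simp
  also have "\<dots> = real (Suc k) *\<^sub>R (\<Sum>is\<in>?A. chaos_coeff m n k is \<omega> *\<^sub>R x is)"
    by (simp only: sum_constant_scaleR card_atMost)
  finally show ?thesis ..
qed

text \<open>
  Every summand is at most the largest one, whose power is one of the summands on the right.
\<close>
lemma powr_sum_le:
  fixes a :: "'a \<Rightarrow> real"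
  assumes "finite L" "0 \<le> p" "\<And>l. l \<in> L \<Longrightarrow> 0 \<le> a l"
  shows "(\<Sum>l\<in>L. a l) powr p \<le> real (card L) powr p * (\<Sum>l\<in>L. a l powr p)"
proof (cases "L = {}")
  case False
  define b where "b = Max (a ` L)"
  have "b \<in> a ` L"
    unfolding b_def using assms(1) False by (intro Max_in) auto
  then obtain l where l: "l \<in> L" "b = a l" by auto
  have "(\<Sum>l\<in>L. a l) \<le> real (card L) * b"
    using assms(1) by (intro sum_bounded_above) (auto simp: b_def)
  then have "(\<Sum>l\<in>L. a l) powr p \<le> (real (card L) * b) powr p"
    using assms by (intro powr_mono2 sum_nonneg) auto
  also have "\<dots> = real (card L) powr p * a l powr p"
    using assms(3) l by (simp add: powr_mult)
  also have "\<dots> \<le> real (card L) powr p * (\<Sum>l\<in>L. a l powr p)"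
    using assms(1) l(1) by (intro mult_left_mono member_le_sum) auto
  finally show ?thesis .
qed simp

lemma chaos_moment_le_Suc:
  assumes p: "0 < p" and k: "1 \<le> k" "k < m"
  shows "\<exists>B. 0 \<le> B \<and> (\<forall>n (x :: nat list \<Rightarrow> 'e::real_normed_vector). symmetric_family m x \<longrightarrow>
    chaos_moment p m n k x \<le> ennreal B * chaos_moment p m n (Suc k) x)"
proof -
  have "1 \<le> Suc k" by simp
  from exists_linear_coefficient_functional [OF this] obtain w :: "nat \<Rightarrow> real" where
    w: "\<And>q :: real poly. degree q \<le> Suc k \<Longrightarrow> (\<Sum>l\<le>Suc k. w l * poly q (2 ^ l)) = coeff q 1"
    by blast
  define r :: "nat \<Rightarrow> real" where "r l = sqrt (1 + (2 ^ l)\<^sup>2)" for l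
  define v where "v l = w l * r l ^ Suc k" for l
  define D where "D = real (card {..Suc k}) powr p"
  have r_pos: "0 < r l" for l
    unfolding r_def by (simp add: add_pos_nonneg)
  have r2: "(r l)\<^sup>2 = 1 + (2 ^ l)\<^sup>2" for l
    unfolding r_def by (simp add: add_nonneg_nonneg)
  have cs: "(1 / r l)\<^sup>2 + (2 ^ l / r l)\<^sup>2 = 1" for l
  proof -
    have "(1 / r l)\<^sup>2 + (2 ^ l / r l)\<^sup>2 = (1 + (2 ^ l)\<^sup>2) / (r l)\<^sup>2"
      by (simp add: power_divide add_divide_distrib)
    then show ?thesis
      unfolding r2 [symmetric] using r_pos [of l] by simp
  qed
  have s: "0 < 2 ^ l / r l" for l
    using r_pos by simp
  have "chaos_moment p m n k x \<le> ennreal (D * (\<Sum>l\<le>Suc k. \<bar>v l\<bar> powr p)) * chaos_moment p m n (Suc k) x"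
    if sym: "symmetric_family m x" for n and x :: "nat list \<Rightarrow> 'e"
  proof -
    let ?K = "{1..m} \<times> {1..n}"
    let ?S = "\<lambda>k \<omega>. \<Sum>is\<in>multi_indices m n. chaos_coeff m n k is \<omega> *\<^sub>R x is"
    let ?R = "\<lambda>l. reflect_rows (1 / r l) (2 ^ l / r l) (Suc k) {1..n}"
    let ?F = "\<lambda>\<omega>. ennreal (norm (?S (Suc k) \<omega>) powr p)"
    have rows: "{1, Suc k} \<times> {1..n} \<subseteq> ?K"
      using k by auto
    have F: "?F \<in> borel_measurable (PiM ?K (\<lambda>_. gauss))"
      using k by (intro borel_measurable_norm_combination_powr borel_measurable_chaos_coeff) auto
    have R: "?R l \<in> PiM ?K (\<lambda>_. gauss) \<rightarrow>\<^sub>M PiM ?K (\<lambda>_. gauss)" for l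
      using k by (intro measurable_reflect_rows rows) auto
    have FR: "(\<lambda>\<omega>. ?F (?R l \<omega>)) \<in> borel_measurable (PiM ?K (\<lambda>_. gauss))" for l
      by (rule measurable_compose [OF R F])
    have pointwise: "ennreal (norm (?S k \<omega>) powr p)
        \<le> (\<Sum>l\<le>Suc k. ennreal (D * \<bar>v l\<bar> powr p) * ?F (?R l \<omega>))" for \<omega>
    proof -
      have "norm (?S k \<omega>) \<le> norm (real (Suc k) *\<^sub>R ?S k \<omega>)"
        using mult_right_mono [of 1 "real (Suc k)" "norm (?S k \<omega>)"] by (simp only: norm_scaleR) simp
      also have "real (Suc k) *\<^sub>R ?S k \<omega> = (\<Sum>l\<le>Suc k. v l *\<^sub>R ?S (Suc k) (?R l \<omega>))"
        unfolding v_def by (rule chaos_eq_sum_reflected [OF sym k w r_def])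
      also have "norm \<dots> \<le> (\<Sum>l\<le>Suc k. \<bar>v l\<bar> * norm (?S (Suc k) (?R l \<omega>)))"
        by (rule sum_norm_le) simp
      finally have "norm (?S k \<omega>) powr p \<le> (\<Sum>l\<le>Suc k. \<bar>v l\<bar> * norm (?S (Suc k) (?R l \<omega>))) powr p"
        using p by (intro powr_mono2) auto
      also have "\<dots> \<le> D * (\<Sum>l\<le>Suc k. (\<bar>v l\<bar> * norm (?S (Suc k) (?R l \<omega>))) powr p)"
        unfolding D_def using p by (intro powr_sum_le) auto
      also have "\<dots> = (\<Sum>l\<le>Suc k. D * \<bar>v l\<bar> powr p * norm (?S (Suc k) (?R l \<omega>)) powr p)"
        unfolding sum_distrib_left by (intro sum.cong refl) (simp add: powr_mult)
      finally have "ennreal (norm (?S k \<omega>) powr p)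
          \<le> ennreal (\<Sum>l\<le>Suc k. D * \<bar>v l\<bar> powr p * norm (?S (Suc k) (?R l \<omega>)) powr p)"
        by (rule ennreal_leI)
      also have "\<dots> = (\<Sum>l\<le>Suc k. ennreal (D * \<bar>v l\<bar> powr p * norm (?S (Suc k) (?R l \<omega>)) powr p))"
        by (intro sum_ennreal [symmetric]) (simp add: D_def)
      also have "\<dots> = (\<Sum>l\<le>Suc k. ennreal (D * \<bar>v l\<bar> powr p) * ?F (?R l \<omega>))"
        by (intro sum.cong refl ennreal_mult) (simp_all add: D_def)
      finally show ?thesis .
    qed
    have "chaos_moment p m n k x
        \<le> (\<integral>\<^sup>+\<omega>. (\<Sum>l\<le>Suc k. ennreal (D * \<bar>v l\<bar> powr p) * ?F (?R l \<omega>)) \<partial>PiM ?K (\<lambda>_. gauss))"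
      unfolding chaos_moment_def by (rule nn_integral_mono, rule pointwise)
    also have "\<dots> = (\<Sum>l\<le>Suc k. \<integral>\<^sup>+\<omega>. ennreal (D * \<bar>v l\<bar> powr p) * ?F (?R l \<omega>) \<partial>PiM ?K (\<lambda>_. gauss))"
      by (rule nn_integral_sum, rule borel_measurable_times_ennreal, rule measurable_const, simp, rule FR)
    also have "\<dots> = (\<Sum>l\<le>Suc k. ennreal (D * \<bar>v l\<bar> powr p) * chaos_moment p m n (Suc k) x)"
    proof (intro sum.cong refl)
      fix l
      have "(\<integral>\<^sup>+\<omega>. ?F (?R l \<omega>) \<partial>PiM ?K (\<lambda>_. gauss)) = chaos_moment p m n (Suc k) x"
        unfolding chaos_moment_def using k
        by (intro nn_integral_reflect_rows [where F = ?F] rows s cs F) auto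
      then show "(\<integral>\<^sup>+\<omega>. ennreal (D * \<bar>v l\<bar> powr p) * ?F (?R l \<omega>) \<partial>PiM ?K (\<lambda>_. gauss))
          = ennreal (D * \<bar>v l\<bar> powr p) * chaos_moment p m n (Suc k) x"
        by (subst nn_integral_cmult [OF FR]) (simp only:)
    qed
    also have "\<dots> = ennreal (D * (\<Sum>l\<le>Suc k. \<bar>v l\<bar> powr p)) * chaos_moment p m n (Suc k) x"
      unfolding sum_distrib_right [symmetric] sum_distrib_left
      by (subst sum_ennreal) (simp_all add: D_def)
    finally show ?thesis .
  qed
  moreover have "0 \<le> D * (\<Sum>l\<le>Suc k. \<bar>v l\<bar> powr p)"
    by (simp add: D_def sum_nonneg)
  ultimately show ?thesis by blast
qed

lemma chaos_moment_equivalent: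
  assumes p: "1 < p" and k: "1 \<le> k" "k \<le> m"
  shows "\<exists>B. 0 \<le> B \<and> (\<forall>n (x :: nat list \<Rightarrow> 'e::real_normed_vector). symmetric_family m x \<longrightarrow>
    chaos_moment p m n 1 x \<le> ennreal B * chaos_moment p m n k x \<and>
    chaos_moment p m n k x \<le> ennreal B * chaos_moment p m n 1 x)"
  using k
proof (induction k rule: dec_induct)
  case base
  show ?case by (intro exI [of _ 1]) simp
next
  case (step k)
  then have k: "1 \<le> k" "k < m" by auto
  obtain B where B: "0 \<le> B" and BI: "\<And>n (x :: nat list \<Rightarrow> 'e). symmetric_family m x \<Longrightarrow>
      chaos_moment p m n 1 x \<le> ennreal B * chaos_moment p m n k x \<and>
      chaos_moment p m n k x \<le> ennreal B * chaos_moment p m n 1 x"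
    using step by auto
  obtain D where D: "0 \<le> D" and DI: "\<And>n (x :: nat list \<Rightarrow> 'e). symmetric_family m x \<Longrightarrow>
      chaos_moment p m n k x \<le> ennreal D * chaos_moment p m n (Suc k) x"
    using chaos_moment_le_Suc [OF _ k, of p] p by (metis less_trans zero_less_one)
  define U where "U = (sqrt 2 ^ Suc k) powr p"
  have U: "0 \<le> U" by (simp add: U_def)
  have "chaos_moment p m n 1 x \<le> ennreal (B * D + U * B) * chaos_moment p m n (Suc k) x \<and>
    chaos_moment p m n (Suc k) x \<le> ennreal (B * D + U * B) * chaos_moment p m n 1 x"
    if sym: "symmetric_family m x" for n and x :: "nat list \<Rightarrow> 'e"
  proof
    have "chaos_moment p m n 1 x \<le> ennreal B * (ennreal D * chaos_moment p m n (Suc k) x)"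
      using BI [OF sym, of n] DI [OF sym, of n] by (meson mult_left_mono order_trans zero_le)
    also have "\<dots> = ennreal (B * D) * chaos_moment p m n (Suc k) x"
      using B D by (simp add: ennreal_mult mult.assoc)
    also have "\<dots> \<le> ennreal (B * D + U * B) * chaos_moment p m n (Suc k) x"
      using B U by (intro mult_right_mono ennreal_leI) auto
    finally show "chaos_moment p m n 1 x \<le> \<dots>" .
    have "chaos_moment p m n (Suc k) x \<le> ennreal U * (ennreal B * chaos_moment p m n 1 x)"
      using BI [OF sym, of n] chaos_moment_Suc_le [OF p k, of n x, folded U_def]
      by (meson mult_left_mono order_trans zero_le)
    also have "\<dots> = ennreal (U * B) * chaos_moment p m n 1 x"
      using B U by (simp add: ennreal_mult mult.assoc)
    also have "\<dots> \<le> ennreal (B * D + U * B) * chaos_moment p m n 1 x"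
      using B D by (intro mult_right_mono ennreal_leI) auto
    finally show "chaos_moment p m n (Suc k) x \<le> \<dots>" .
  qed
  moreover have "0 \<le> B * D + U * B"
    using B D U by simp
  ultimately show ?case by blast
qed

section \<open>Transfer to the given Gaussian variables\<close>

text \<open>
  Independence together with the marginal laws determines the joint law, so moments can be computed
  under the product measure.
\<close>
lemma nn_integral_iid_std_gaussian:
  assumes "prob_space M" and iid: "iid_std_gaussian M I X" and K: "K \<subseteq> I" "K \<noteq> {}"
    and F: "F \<in> borel_measurable (PiM K (\<lambda>_. gauss))"
  shows "(\<lambda>\<omega>. \<lambda>i\<in>K. X i \<omega>) \<in> M \<rightarrow>\<^sub>M PiM K (\<lambda>_. gauss)"
    and "(\<integral>\<^sup>+\<omega>. F (\<lambda>i\<in>K. X i \<omega>) \<partial>M) = (\<integral>\<^sup>+\<omega>. F \<omega> \<partial>PiM K (\<lambda>_. gauss))"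
proof -
  interpret prob_space M by fact
  have indep: "indep_vars (\<lambda>_. borel) X K"
    using iid K(1) by (auto simp: iid_std_gaussian_def intro: indep_vars_subset)
  have rv: "X i \<in> borel_measurable M" if "i \<in> K" for i
    using indep that by (auto simp: indep_vars_def)
  have law: "distr M borel (X i) = gauss" if "i \<in> K" for i
  proof -
    have "distributed M lborel (X i) (\<lambda>t. ennreal (std_normal_density t))"
      using iid K(1) that by (auto simp: iid_std_gaussian_def)
    then have "distr M lborel (X i) = gauss"
      by (simp add: gauss_def distributed_def)
    then show ?thesis
      by (simp cong: distr_cong)
  qed
  have sets: "sets (PiM K (\<lambda>_. gauss)) = sets (PiM K (\<lambda>_. borel :: real measure))"
    by (rule sets_PiM_cong) simp_all
  have "(\<lambda>\<omega>. \<lambda>i\<in>K. X i \<omega>) \<in> M \<rightarrow>\<^sub>M PiM K (\<lambda>_. borel)"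
    using rv by (rule measurable_restrict)
  then show meas: "(\<lambda>\<omega>. \<lambda>i\<in>K. X i \<omega>) \<in> M \<rightarrow>\<^sub>M PiM K (\<lambda>_. gauss)"
    by (simp add: measurable_cong_sets [OF refl sets])
  have "distr M (PiM K (\<lambda>_. gauss)) (\<lambda>\<omega>. \<lambda>i\<in>K. X i \<omega>) = distr M (PiM K (\<lambda>_. borel)) (\<lambda>\<omega>. \<lambda>i\<in>K. X i \<omega>)"
    by (rule distr_cong) (simp_all add: sets)
  also have "\<dots> = PiM K (\<lambda>i. distr M borel (X i))"
    using indep_vars_iff_distr_eq_PiM' [OF K(2) rv] indep by simp
  also have "\<dots> = PiM K (\<lambda>_. gauss)"
    by (rule PiM_cong) (simp_all add: law)
  finally have joint: "distr M (PiM K (\<lambda>_. gauss)) (\<lambda>\<omega>. \<lambda>i\<in>K. X i \<omega>) = PiM K (\<lambda>_. gauss)" .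
  show "(\<integral>\<^sup>+\<omega>. F (\<lambda>i\<in>K. X i \<omega>) \<partial>M) = (\<integral>\<^sup>+\<omega>. F \<omega> \<partial>PiM K (\<lambda>_. gauss))"
    using nn_integral_distr [OF meas, of F] F unfolding joint by simp
qed

lemma Lp_norm_eq_nn_integral:
  assumes "(\<lambda>\<omega>. ennreal (norm (f \<omega>) powr p)) \<in> borel_measurable M"
  shows "Lp_norm M p f = enn2real (\<integral>\<^sup>+\<omega>. ennreal (norm (f \<omega>) powr p) \<partial>M) powr (1 / p)"
proof -
  have "(\<lambda>\<omega>. enn2real (ennreal (norm (f \<omega>) powr p))) \<in> borel_measurable M"
    using assms by measurable
  then have "(\<lambda>\<omega>. norm (f \<omega>) powr p) \<in> borel_measurable M"
    by simp
  then show ?thesis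
    unfolding Lp_norm_def by (subst integral_eq_nn_integral) auto
qed

text \<open>
  For \<open>k = 1\<close> the Wick product has a single factor, so \<open>chaos_coeff\<close> is a plain product over the rows.
\<close>
lemma Lp_norm_decoupled_chaos:
  fixes x :: "nat list \<Rightarrow> 'e::real_normed_vector"
  assumes M: "prob_space M" and iid: "iid_std_gaussian M ({1..} \<times> {1..}) \<gamma>'" and mn: "1 \<le> m" "1 \<le> n"
  shows "Lp_norm M p (decoupled_chaos \<gamma>' m n x) = enn2real (chaos_moment p m n 1 x) powr (1 / p)"
proof -
  let ?K = "{1..m} \<times> {1..n}"
  let ?F = "\<lambda>\<omega>. ennreal (norm (\<Sum>is\<in>multi_indices m n. chaos_coeff m n 1 is \<omega> *\<^sub>R x is) powr p)"
  have F: "?F \<in> borel_measurable (PiM ?K (\<lambda>_. gauss))"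
    using mn by (intro borel_measurable_norm_combination_powr borel_measurable_chaos_coeff)
  have K: "?K \<subseteq> {1..} \<times> {1..}" "?K \<noteq> {}"
    using mn by auto
  note transfer = nn_integral_iid_std_gaussian [OF M iid K F]
  have coeff: "chaos_coeff m n 1 is (\<lambda>i\<in>?K. \<gamma>' i \<omega>) = (\<Prod>k=1..m. \<gamma>' (k, is ! (k - 1)) \<omega>)"
    if "is": "is \<in> multi_indices m n" for "is" \<omega>
  proof -
    let ?\<omega> = "\<lambda>i\<in>?K. \<gamma>' i \<omega>"
    have entry: "is ! (l - 1) \<in> {1..n}" if "l \<in> {1..m}" for l
      using multi_indices_nth [OF "is", of "l - 1"] that by auto
    have count: "count_list (take 1 is) j = (if j = is ! 0 then 1 else 0)" for j
      using count_list_take_Suc [OF "is", of 0 j] mn by simp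
    have "(\<Prod>j\<in>{1..n}. poly (hermite_poly (count_list (take 1 is) j)) (?\<omega> (1, j)))
        = (\<Prod>j\<in>{1..n}. if j = is ! 0 then ?\<omega> (1, j) else 1)"
      unfolding count by (intro prod.cong refl) simp
    also have "\<dots> = \<gamma>' (1, is ! 0) \<omega>"
      using entry [of 1] mn by simp
    finally have 1: "(\<Prod>j\<in>{1..n}. poly (hermite_poly (count_list (take 1 is) j)) (?\<omega> (1, j))) = \<gamma>' (1, is ! 0) \<omega>" .
    have 2: "(\<Prod>l\<in>{1+1..m}. ?\<omega> (l, is ! (l - 1))) = (\<Prod>l\<in>{1+1..m}. \<gamma>' (l, is ! (l - 1)) \<omega>)"
      using entry by (intro prod.cong refl) auto
    have "(\<Prod>k=1..m. \<gamma>' (k, is ! (k - 1)) \<omega>) = \<gamma>' (1, is ! 0) \<omega> * (\<Prod>l\<in>{1+1..m}. \<gamma>' (l, is ! (l - 1)) \<omega>)"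
      using mn by (subst prod.atLeast_Suc_atMost) auto
    then show ?thesis
      unfolding chaos_coeff_def 1 2 by simp
  qed
  have eq: "ennreal (norm (decoupled_chaos \<gamma>' m n x \<omega>) powr p) = ?F (\<lambda>i\<in>?K. \<gamma>' i \<omega>)" for \<omega>
    unfolding decoupled_chaos_def by (simp only: coeff cong: sum.cong)
  show ?thesis
    using Lp_norm_eq_nn_integral [of "decoupled_chaos \<gamma>' m n x" p M] transfer(2)
      measurable_compose [OF transfer(1) F]
    unfolding eq chaos_moment_def by simp
qed

text \<open>
  The two square roots of \<open>multi_fact is\<close> in the chaos combine to the factorials that make the Hermite
  polynomials monic; only \<open>1 / sqrt (fact m)\<close> remains. For \<open>k = m\<close> the coefficient involves row 1 only,
  so its moment over the whole array is a moment over one row, whose law is that of \<open>\<gamma>\<close>.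
\<close>
lemma Lp_norm_chaos:
  fixes x :: "nat list \<Rightarrow> 'e::real_normed_vector"
  assumes M: "prob_space M" and iid: "iid_std_gaussian M {1..} \<gamma>" and mn: "1 \<le> m" "1 \<le> n" and p: "1 < p"
  shows "Lp_norm M p (chaos \<gamma> m n x) = enn2real (chaos_moment p m n m x) powr (1 / p) / sqrt (fact m)"
proof -
  let ?A = "multi_indices m n"
  define w where "w is y = (\<Prod>j\<in>{1..n}. poly (hermite_poly (count_list is j)) (y j))" for "is" and y :: "nat \<Rightarrow> real"
  define F where "F y = ennreal (norm (\<Sum>is\<in>?A. w is y *\<^sub>R x is) powr p)" for y
  have comp: "(\<lambda>y. y j) \<in> borel_measurable (PiM {1..n} (\<lambda>_. gauss))" if "j \<in> {1..n}" for j
    using measurable_component_singleton [OF that, of "\<lambda>_. gauss"]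
    by (simp add: measurable_cong_sets [OF refl sets_gauss])
  have poly: "(\<lambda>t. poly q t) \<in> borel_measurable borel" for q :: "real poly"
    by (intro borel_measurable_continuous_onI continuous_intros)
  have F: "F \<in> borel_measurable (PiM {1..n} (\<lambda>_. gauss))"
    unfolding F_def [abs_def] w_def [abs_def]
    by (intro borel_measurable_norm_combination_powr borel_measurable_prod measurable_compose [OF _ poly] comp)
  have K: "{1..n} \<subseteq> {1..}" "{1..n} \<noteq> {}"
    using mn by auto
  note transfer = nn_integral_iid_std_gaussian [OF M iid K F]
  have restrict: "w is (\<lambda>j\<in>{1..n}. y j) = w is y" for "is" y
    unfolding w_def by (intro prod.cong) auto
  have coeff: "sqrt (multi_fact is / fact m) * Psi \<gamma> is \<omega> = w is (\<lambda>j. \<gamma> j \<omega>) / sqrt (fact m)"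
    if "is": "is \<in> ?A" for "is" \<omega>
  proof -
    have set: "set is \<subseteq> {1..n}"
      using "is" by (simp add: multi_indices_def)
    have "sqrt (multi_fact is / fact m) * Psi \<gamma> is \<omega>
        = (sqrt (multi_fact is) * sqrt (multi_fact is)) * (\<Prod>j\<in>set is. hermite (count_list is j) (\<gamma> j \<omega>)) / sqrt (fact m)"
      by (simp add: Psi_def real_sqrt_divide)
    also have "sqrt (multi_fact is) * sqrt (multi_fact is) = multi_fact is"
      by (simp add: multi_fact_def prod_nonneg)
    also have "multi_fact is * (\<Prod>j\<in>set is. hermite (count_list is j) (\<gamma> j \<omega>))
        = (\<Prod>j\<in>set is. poly (hermite_poly (count_list is j)) (\<gamma> j \<omega>))"
      by (simp add: multi_fact_def poly_hermite_poly prod.distrib)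
    also have "\<dots> = w is (\<lambda>j. \<gamma> j \<omega>)"
      unfolding w_def using set by (intro prod.mono_neutral_left) auto
    finally show ?thesis .
  qed
  have "chaos \<gamma> m n x \<omega> = (1 / sqrt (fact m)) *\<^sub>R (\<Sum>is\<in>?A. w is (\<lambda>j\<in>{1..n}. \<gamma> j \<omega>) *\<^sub>R x is)" for \<omega>
    unfolding chaos_def restrict scaleR_sum_right scaleR_scaleR
    by (intro sum.cong refl) (simp add: coeff)
  then have "norm (chaos \<gamma> m n x \<omega>) powr p
      = (1 / sqrt (fact m)) powr p * norm (\<Sum>is\<in>?A. w is (\<lambda>j\<in>{1..n}. \<gamma> j \<omega>) *\<^sub>R x is) powr p" for \<omega>
    by (simp only: norm_scaleR powr_mult) simp
  then have eq: "ennreal (norm (chaos \<gamma> m n x \<omega>) powr p)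
      = ennreal ((1 / sqrt (fact m)) powr p) * F (\<lambda>j\<in>{1..n}. \<gamma> j \<omega>)" for \<omega>
    unfolding F_def by (simp only: ennreal_mult powr_ge_zero)
  have FX: "(\<lambda>\<omega>. F (\<lambda>j\<in>{1..n}. \<gamma> j \<omega>)) \<in> borel_measurable M"
    by (rule measurable_compose [OF transfer(1) F])
  let ?K = "{1..m} \<times> {1..n}"
  have moment: "chaos_moment p m n m x = (\<integral>\<^sup>+y. F y \<partial>PiM {1..n} (\<lambda>_. gauss))"
  proof -
    have distr: "distr (PiM ?K (\<lambda>_. gauss)) (PiM {1..n} (\<lambda>_. gauss)) (\<lambda>\<omega>. \<lambda>j\<in>{1..n}. \<omega> (1, j)) = PiM {1..n} (\<lambda>_. gauss)"
      using mn by (intro distr_PiM_reindex [where f = "Pair 1"] gauss.prob_space_axioms) (auto simp: inj_on_def)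
    have meas: "(\<lambda>\<omega>. \<lambda>j\<in>{1..n}. \<omega> (1, j)) \<in> PiM ?K (\<lambda>_. gauss) \<rightarrow>\<^sub>M PiM {1..n} (\<lambda>_. gauss)"
      using mn by (intro measurable_restrict measurable_component_singleton) auto
    have "chaos_coeff m n m is \<omega> = w is (\<lambda>j\<in>{1..n}. \<omega> (1, j))" if "is \<in> ?A" for "is" \<omega>
      unfolding restrict using that by (simp add: chaos_coeff_def w_def multi_indices_def)
    then have "chaos_moment p m n m x = (\<integral>\<^sup>+\<omega>. F (\<lambda>j\<in>{1..n}. \<omega> (1, j)) \<partial>PiM ?K (\<lambda>_. gauss))"
      unfolding chaos_moment_def F_def by (simp cong: sum.cong)
    also have "\<dots> = (\<integral>\<^sup>+y. F y \<partial>PiM {1..n} (\<lambda>_. gauss))"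
      using nn_integral_distr [OF meas, of F] F unfolding distr by simp
    finally show ?thesis .
  qed
  have integral: "(\<integral>\<^sup>+\<omega>. ennreal (norm (chaos \<gamma> m n x \<omega>) powr p) \<partial>M)
      = ennreal ((1 / sqrt (fact m)) powr p) * chaos_moment p m n m x"
    unfolding eq moment nn_integral_cmult [OF FX] transfer(2) ..
  have meas: "(\<lambda>\<omega>. ennreal (norm (chaos \<gamma> m n x \<omega>) powr p)) \<in> borel_measurable M"
    unfolding eq using FX by (intro borel_measurable_times_ennreal) simp_all
  have "((1 / sqrt (fact m)) powr p) powr (1 / p) = 1 / sqrt (fact m)"
    using p by (simp only: powr_powr) simp
  then show ?thesis
    unfolding Lp_norm_eq_nn_integral [OF meas] integral
    by (simp add: enn2real_mult powr_mult)
qed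

text \<open>
  Both inequalities are needed: \<^const>\<open>enn2real\<close> sends \<open>\<infinity>\<close> to 0, so it has to be excluded that \<open>b\<close> is
  infinite while \<open>a\<close> is finite.
\<close>
lemma enn2real_le_cmult:
  assumes "a \<le> ennreal B * b" "b \<le> ennreal B * a" "0 \<le> B"
  shows "enn2real a \<le> B * enn2real b"
proof (cases "b = \<infinity>")
  case True
  then have "ennreal B * a = \<infinity>"
    using assms(2) by (simp add: top_unique)
  then have "a = \<infinity>"
    by (auto simp: ennreal_mult_eq_top_iff)
  then show ?thesis using True by simp
next
  case False
  then have "ennreal B * b < \<infinity>"
    by (simp add: ennreal_mult_less_top less_top)
  from enn2real_mono [OF assms(1)] this show ?thesis
    using assms(3) by (simp add: enn2real_mult)
qed

theorem theorem6p11: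
  fixes p :: real and m :: nat
  assumes "UMD_space TYPE('e::banach)" and "1 < p" and "1 \<le> m"
  shows "\<exists>C::real. 1 \<le> C \<and>
    (\<forall>(M :: 'w measure) (\<gamma> :: nat \<Rightarrow> 'w \<Rightarrow> real) (\<gamma>' :: nat \<times> nat \<Rightarrow> 'w \<Rightarrow> real)
       (n::nat) (x :: nat list \<Rightarrow> 'e).
       prob_space M \<longrightarrow>
       iid_std_gaussian M {1..} \<gamma> \<longrightarrow>
       iid_std_gaussian M ({1..} \<times> {1..}) \<gamma>' \<longrightarrow>
       1 \<le> n \<longrightarrow>
       symmetric_family m x \<longrightarrow>
       inverse C * Lp_norm M p (decoupled_chaos \<gamma>' m n x) \<le> Lp_norm M p (chaos \<gamma> m n x) \<and>
       Lp_norm M p (chaos \<gamma> m n x) \<le> C * Lp_norm M p (decoupled_chaos \<gamma>' m n x))"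
proof -
  obtain B where B: "0 \<le> B" and BI: "\<And>n (x :: nat list \<Rightarrow> 'e). symmetric_family m x \<Longrightarrow>
      chaos_moment p m n 1 x \<le> ennreal B * chaos_moment p m n m x \<and>
      chaos_moment p m n m x \<le> ennreal B * chaos_moment p m n 1 x"
    using chaos_moment_equivalent [OF assms(2,3) order_refl] by blast
  define D where "D = B powr (1 / p)"
  \<comment> \<open>The factor \<open>sqrt (fact m)\<close> compensates the normalisation of the chaos in the lower bound.\<close>
  define C where "C = 1 + D * sqrt (fact m)"
  have D: "0 \<le> D" by (simp add: D_def)
  have f: "1 \<le> sqrt (fact m :: real)" by simp
  have C: "1 \<le> C" "D * sqrt (fact m) \<le> C"
    using D by (simp_all add: C_def)
  have "D \<le> C"
    using C(2) mult_left_mono [OF f D] by simp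
  show ?thesis
  proof (intro exI [of _ C] conjI allI impI C(1))
    fix M :: "'w measure" and \<gamma> :: "nat \<Rightarrow> 'w \<Rightarrow> real"
      and \<gamma>' :: "nat \<times> nat \<Rightarrow> 'w \<Rightarrow> real" and n :: nat and x :: "nat list \<Rightarrow> 'e"
    assume M: "prob_space M" and \<gamma>: "iid_std_gaussian M {1..} \<gamma>"
      and \<gamma>': "iid_std_gaussian M ({1..} \<times> {1..}) \<gamma>'" and n: "1 \<le> n" and sym: "symmetric_family m x"
    define a where "a = Lp_norm M p (decoupled_chaos \<gamma>' m n x)"
    define b where "b = enn2real (chaos_moment p m n m x) powr (1 / p)"
    have a_eq: "a = enn2real (chaos_moment p m n 1 x) powr (1 / p)"
      unfolding a_def by (rule Lp_norm_decoupled_chaos [OF M \<gamma>' assms(3) n])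
    have b_eq: "Lp_norm M p (chaos \<gamma> m n x) = b / sqrt (fact m)"
      unfolding b_def by (rule Lp_norm_chaos [OF M \<gamma> assms(3) n assms(2)])
    have root: "u powr (1 / p) \<le> D * v powr (1 / p)" if "u \<le> B * v" "0 \<le> u" "0 \<le> v" for u v
    proof -
      have "u powr (1 / p) \<le> (B * v) powr (1 / p)"
        using that assms(2) by (intro powr_mono2) auto
      then show ?thesis using B that by (simp add: D_def powr_mult)
    qed
    have ab: "a \<le> D * b" "b \<le> D * a"
    proof -
      have le: "chaos_moment p m n 1 x \<le> ennreal B * chaos_moment p m n m x"
        "chaos_moment p m n m x \<le> ennreal B * chaos_moment p m n 1 x"
        using BI [OF sym] by auto
      show "a \<le> D * b"
        unfolding a_eq b_def by (intro root enn2real_le_cmult [OF le B] enn2real_nonneg)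
      show "b \<le> D * a"
        unfolding a_eq b_def by (intro root enn2real_le_cmult [OF le(2,1) B] enn2real_nonneg)
    qed
    have nonneg: "0 \<le> a" "0 \<le> b"
      by (simp_all add: a_eq b_def)
    have cross: "a * sqrt (fact m) \<le> C * b"
    proof -
      have "a * sqrt (fact m) \<le> (D * b) * sqrt (fact m)"
        using ab(1) f by (intro mult_right_mono) auto
      also have "\<dots> = (D * sqrt (fact m)) * b" by simp
      also have "\<dots> \<le> C * b"
        using C(2) nonneg by (intro mult_right_mono)
      finally show ?thesis .
    qed
    show "inverse C * Lp_norm M p (decoupled_chaos \<gamma>' m n x) \<le> Lp_norm M p (chaos \<gamma> m n x)"
    proof -
      have "a \<le> C * b / sqrt (fact m)"
        using cross by (subst pos_le_divide_eq) auto
      then have "inverse C * a \<le> inverse C * (C * b / sqrt (fact m))"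
        using C(1) by (intro mult_left_mono) auto
      also have "\<dots> = b / sqrt (fact m)"
        using C(1) by simp
      finally show ?thesis
        unfolding b_eq a_def .
    qed
    have "b / sqrt (fact m) \<le> b / 1"
      using nonneg f by (intro divide_left_mono) auto
    then have "b / sqrt (fact m) \<le> b" by simp
    also have "\<dots> \<le> C * a"
      using ab(2) mult_right_mono [OF \<open>D \<le> C\<close> nonneg(1)] by simp
    finally show "Lp_norm M p (chaos \<gamma> m n x) \<le> C * Lp_norm M p (decoupled_chaos \<gamma>' m n x)"
      unfolding b_eq a_def .
  qed
qed

end
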